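(* There is an open set $H_\beta\subset\mathbb{C}$ containing $\mathbb{C}-M_{\beta,0}$ and every simple centre, such that the set functions $c\mapsto J_c$ and $c\mapsto J_c^*$ are continuous on $H_\beta$ with respect to the Hausdorff distance.
   Context: Fix integers $p>q\ge 1$, $\beta=p/q$. For $c\in\mathbb{C}$, $\mathbf{f}_c(z)=\{w:(w-c)^q=z^p\}$ for $z\in\mathbb{C}$, $\mathbf{f}_c(\infty)=\{\infty\}$. A forward orbit is a sequence with $z_{i+1}\in\mathbf{f}_c(z_i)$; a cycle is a periodic forward orbit. A branch of $\mathbf{f}_c$ is a holomorphic $\varphi$ with $(\varphi(z)-c)^q=z^p$ on its domain. A cycle $(z_i)$ of period $n$ in $\mathbb{C}$ is attracting if it contains $0$, or if it does not contain $0$ and its multiplier $\lambda=\prod_{i=0}^{n-1}\varphi_i'(z_i)$ ($\varphi_i$ a branch with $\varphi_i(z_i)=z_{i+1}$) satisfies $|\lambda|<1$; it is repelling if it does not contain $0$ and $|\lambda|>1$. The Julia set $J_c$ is the closure of the union of all repelling cycles; the dual Julia set $J_c^*$ is the closure of the union of all attracting cycles in $\mathbb{C}$ (excluding $\infty$). $K_c$ is the set of points of $\mathbb{C}$ having at least one bounded forward orbit under $\mathbf{f}_c$, and $M_{\beta,0}=\{c\in\mathbb{C}:0\in K_c\}$. A parameter $c$ is a simple centre if $0$ has only one bounded forward orbit under $\mathbf{f}_c$ and this orbit is a cycle. The set $J_c^*$ may be empty; continuity of $c\mapsto J_c^*$ at a parameter $c_0$ with $J_{c_0}^*=\emptyset$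 means that $J_c^*=\emptyset$ for all $c$ near $c_0$. *)

theory Defs
  imports "HOL-Complex_Analysis.Complex_Analysis"
begin

(* The point at infinity is fixed by the correspondence and no finite point is mapped to it, so
   forward orbits starting in the plane stay in the plane. All the notions below concern such
   orbits only, hence everything takes place in the type complex. *)

definition corr :: "nat \<Rightarrow> nat \<Rightarrow> complex \<Rightarrow> complex \<Rightarrow> complex set" where
  "corr p q c z = {w. (w - c) ^ q = z ^ p}"

definition forward_orbit :: "nat \<Rightarrow> nat \<Rightarrow> complex \<Rightarrow> (nat \<Rightarrow> complex) \<Rightarrow> bool" where
  "forward_orbit p q c z \<longleftrightarrow> (\<forall>i. z (Suc i) \<in> corr p q c (z i))"

(* n is a period of the sequence, not necessarily the minimal one. *)
definition corr_cycle :: "nat \<Rightarrow> nat \<Rightarrow> complex \<Rightarrow> nat \<Rightarrow> (nat \<Rightarrow> complex) \<Rightarrow> bool" where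
  "corr_cycle p q c n z \<longleftrightarrow> forward_orbit p q c z \<and> n > 0 \<and> (\<forall>i. z (i + n) = z i)"

definition corr_branch ::
    "nat \<Rightarrow> nat \<Rightarrow> complex \<Rightarrow> complex set \<Rightarrow> (complex \<Rightarrow> complex) \<Rightarrow> bool" where
  "corr_branch p q c U \<phi> \<longleftrightarrow>
     open U \<and> \<phi> holomorphic_on U \<and> (\<forall>z\<in>U. (\<phi> z - c) ^ q = z ^ p)"

(* For a cycle avoiding 0 the germ of a branch at z i with value z (i + 1) exists and is unique,
   so this relation determines exactly one multiplier. *)
definition has_multiplier ::
    "nat \<Rightarrow> nat \<Rightarrow> complex \<Rightarrow> nat \<Rightarrow> (nat \<Rightarrow> complex) \<Rightarrow> complex \<Rightarrow> bool" where
  "has_multiplier p q c n z \<mu> \<longleftrightarrow>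
     (\<exists>U \<phi>. (\<forall>i<n. corr_branch p q c (U i) (\<phi> i) \<and> z i \<in> U i \<and> \<phi> i (z i) = z (Suc i)) \<and>
            \<mu> = (\<Prod>i<n. deriv (\<phi> i) (z i)))"

definition attracting_cycle :: "nat \<Rightarrow> nat \<Rightarrow> complex \<Rightarrow> nat \<Rightarrow> (nat \<Rightarrow> complex) \<Rightarrow> bool" where
  "attracting_cycle p q c n z \<longleftrightarrow> corr_cycle p q c n z \<and>
     (0 \<in> range z \<or> (0 \<notin> range z \<and> (\<exists>\<mu>. has_multiplier p q c n z \<mu> \<and> cmod \<mu> < 1)))"

definition repelling_cycle :: "nat \<Rightarrow> nat \<Rightarrow> complex \<Rightarrow> nat \<Rightarrow> (nat \<Rightarrow> complex) \<Rightarrow> bool" where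
  "repelling_cycle p q c n z \<longleftrightarrow> corr_cycle p q c n z \<and>
     0 \<notin> range z \<and> (\<exists>\<mu>. has_multiplier p q c n z \<mu> \<and> cmod \<mu> > 1)"

definition julia :: "nat \<Rightarrow> nat \<Rightarrow> complex \<Rightarrow> complex set" where
  "julia p q c = closure (\<Union>{range z | n z. repelling_cycle p q c n z})"

definition dual_julia :: "nat \<Rightarrow> nat \<Rightarrow> complex \<Rightarrow> complex set" where
  "dual_julia p q c = closure (\<Union>{range z | n z. attracting_cycle p q c n z})"

definition filled_julia :: "nat \<Rightarrow> nat \<Rightarrow> complex \<Rightarrow> complex set" where
  "filled_julia p q c = {a. \<exists>z. forward_orbit p q c z \<and> z 0 = a \<and> bounded (range z)}"

definition mandel :: "nat \<Rightarrow> nat \<Rightarrow> complex set" where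
  "mandel p q = {c. 0 \<in> filled_julia p q c}"

definition simple_centre :: "nat \<Rightarrow> nat \<Rightarrow> complex \<Rightarrow> bool" where
  "simple_centre p q c \<longleftrightarrow>
     (\<exists>!z. forward_orbit p q c z \<and> z 0 = 0 \<and> bounded (range z)) \<and>
     (\<forall>z. forward_orbit p q c z \<and> z 0 = 0 \<and> bounded (range z) \<longrightarrow> (\<exists>n. corr_cycle p q c n z))"

(* Values in ennreal: the distance from the empty set to itself is 0 and to any nonempty set is
   infinite. Hence continuity at a parameter with empty value means that the set function is empty
   on a whole neighbourhood of that parameter. *)
definition hausdorff_edist :: "'a::metric_space set \<Rightarrow> 'a set \<Rightarrow> ennreal" where
  "hausdorff_edist A B =
     max (SUP a\<in>A. INF b\<in>B. ennreal (dist a b)) (SUP b\<in>B. INF a\<in>A. ennreal (dist a b))"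

definition hausdorff_continuous_on ::
    "'a::topological_space set \<Rightarrow> ('a \<Rightarrow> 'b::metric_space set) \<Rightarrow> bool" where
  "hausdorff_continuous_on S F \<longleftrightarrow>
     (\<forall>x\<in>S. ((\<lambda>y. hausdorff_edist (F y) (F x)) \<longlongrightarrow> 0) (at x within S))"

end

theory Submission
  imports Defs "HOL-Computational_Algebra.Fundamental_Theorem_Algebra"
begin

text \<open>
Away from \<open>0\<close> every branch of the correspondence has derivative of modulus
\<open>speed \<bar>z\<bar> = (p/q) \<bar>z\<bar>\<^bsup>p/q - 1\<^esup>\<close>, so the modulus of a multiplier is the product of the
speeds along the cycle; a cycle through \<open>0\<close> gives the product \<open>0\<close>. Attracting and repelling
therefore mean that this product is \<open>< 1\<close> and \<open>> 1\<close>.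

Near a parameter \<open>c\<^sub>0\<close> outside the Mandelbrot set or near a simple centre there is one open bounded set
\<open>U\<close> that avoids \<open>0\<close> and such that, for all nearby parameters \<open>c\<close>, the preimage of \<open>U\<close>
lies in \<open>U\<close> at distance at least \<open>\<delta>\<close> from the complement (predicate \<open>repeller\<close>). On such a set
the correspondence expands a Kobayashi type metric. Indeed a holomorphic disc \<open>h\<close> in \<open>U\<close> lifts
through the correspondence, because \<open>h - c\<close> has no zeros and so \<open>(h - c)\<^sup>q\<close> has a holomorphic
\<open>p\<close>-th root; the lift \<open>g\<close> stays \<open>\<delta>\<close>-far from the complement, which leaves
room to replace it by \<open>g(\<zeta>) + \<eta> g'(0) \<zeta>\<close> and thereby gain a factor \<open>1 + \<eta>\<close> in the derivative
at the centre. After \<open>N\<close> steps Cauchy's estimate bounds the resulting disc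
(\<open>expanding_disc\<close>, \<open>expansion\<close>). Consequently all cycles in \<open>U\<close> are repelling, and inverse branches of a
fixed high iterate are \<open>1/2\<close>-contractions on balls of uniform radius. Composing such blocks along a
cycle of \<open>c\<close>, but with the inverse branches of a nearby \<open>c'\<close>, Banach's fixed point theorem yields a
cycle of \<open>c'\<close> close to any given point of the cycle (\<open>repeller_shadowing\<close>). The estimate is uniform in
the cycle and symmetric in \<open>c\<close>, \<open>c'\<close>, and this is exactly Hausdorff continuity of the closure of the
union of the cycles in \<open>U\<close>.

If \<open>c\<^sub>0\<close> is outside the Mandelbrot set, \<open>U\<close> is an iterated preimage of a large disc: by a compactness
argument of Koenig type a high preimage omits \<open>0\<close>, and it contains all cycles of nearby parameters. So
the Julia set is continuous and the dual Julia set is empty near \<open>c\<^sub>0\<close>.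

If \<open>c\<^sub>0\<close> is a simple centre, all branches at the points of the cycle through \<open>0\<close> that leave the cycle lead
to escaping points, and one takes for \<open>U\<close> a high preimage of the disc minus small discs around the
cycle. The speed vanishes at \<open>0\<close>, hence with suitably weighted radii the
correspondence contracts these discs, as a set-valued map, into one another (predicate \<open>attractor\<close>). All cycles
that do not lie in \<open>U\<close> stay in the discs and are attracting, and a fixed point argument for
set-valued contractions (\<open>closing\<close>) again shadows cycles of \<open>c\<close> by cycles of \<open>c'\<close>. Note that at \<open>c \<noteq> c\<^sub>0\<close>
there may be infinitely many attracting cycles, because the correspondence is branched at \<open>0\<close>; shadowing
treats them all at once.\<close>

locale correspondence =
  fixes p q :: nat
  assumes q_pos: "q \<ge> 1" and q_less_p: "q < p"
begin

lemma p_pos: "p > 0"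
  using q_less_p by simp

lemma exponent_gt_1: "real p / real q > 1"
  using q_pos q_less_p by (simp add: field_simps)

section \<open>Branches\<close>

definition speed :: "real \<Rightarrow> real" where
  "speed t = real p / real q * t powr (real p / real q - 1)"

lemma speed_nonneg: "speed t \<ge> 0"
  by (simp add: speed_def)

lemma speed_mono: "0 \<le> s \<Longrightarrow> s \<le> t \<Longrightarrow> speed s \<le> speed t"
  unfolding speed_def
  by (intro mult_left_mono powr_mono2) (use exponent_gt_1 in auto)

lemma speed_tendsto_0: "(speed \<longlongrightarrow> 0) (at_right 0)"
proof -
  have "((\<lambda>t. t powr (real p / real q - 1)) \<longlongrightarrow> 0) (at_right 0)"
  proof (rule tendsto_zero_powrI)
    show "\<forall>\<^sub>F x in at_right 0. 0 \<le> (x::real)"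
      by (auto simp: eventually_at_right_less intro: eventually_at_rightI[of 0 1])
  qed (use exponent_gt_1 in \<open>auto intro!: tendsto_eq_intros\<close>)
  from tendsto_mult[OF tendsto_const[of "real p / real q"] this]
  show ?thesis by (simp add: speed_def[abs_def])
qed

text \<open>The value of a branch has a modulus that depends on \<open>\<bar>z\<bar>\<close> only; this is what makes all
branches equally fast.\<close>

lemma norm_of_root:
  fixes u z :: complex
  assumes "u ^ q = z ^ p"
  shows "cmod u = cmod z powr (real p / real q)"
proof -
  have e: "cmod u ^ q = cmod z ^ p"
    using assms by (metis norm_power)
  show ?thesis
  proof (cases "z = 0")
    case True
    then show ?thesis using assms p_pos q_pos by (auto simp: power_0_left)
  next
    case False
    then have u0: "u \<noteq> 0" using e q_pos p_pos
      by (metis norm_eq_zero power_eq_0_iff power_0_left zero_less_norm_iff power_not_zero not_one_le_zero)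
    have "cmod u = (cmod u ^ q) powr (1 / real q)"
      using u0 q_pos by (simp add: powr_powr flip: powr_realpow)
    also have "\<dots> = (cmod z ^ p) powr (1 / real q)"
      using e by simp
    also have "\<dots> = cmod z powr (real p / real q)"
      using False by (simp add: powr_powr flip: powr_realpow)
    finally show ?thesis .
  qed
qed

text \<open>Differentiating \<open>(h - c)\<^sup>q = g\<^sup>p\<close> relates the derivatives of \<open>g\<close> and
\<open>h\<close>. Taking \<open>g\<close> to be the identity gives the derivative of a branch; taking
\<open>g\<close> to be a lift of \<open>h\<close> gives that of an inverse branch.\<close>

lemma deriv_of_branch:
  assumes S: "open S" "w \<in> S" and g: "g holomorphic_on S" and h: "h holomorphic_on S"
    and eq: "\<And>x. x \<in> S \<Longrightarrow> (h x - c) ^ q = g x ^ p" and nz: "g w \<noteq> 0"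
  shows "cmod (deriv h w) = speed (cmod (g w)) * cmod (deriv g w)"
proof -
  have dg: "(g has_field_derivative deriv g w) (at w)"
    using g S holomorphic_derivI by blast
  have dh: "(h has_field_derivative deriv h w) (at w)"
    using h S holomorphic_derivI by blast
  have d1: "((\<lambda>x. (h x - c) ^ q) has_field_derivative of_nat q * (h w - c) ^ (q - 1) * deriv h w) (at w)"
    using DERIV_power[OF DERIV_diff[OF dh DERIV_const[of c]], of q] by (simp add: mult_ac)
  have d2: "((\<lambda>x. g x ^ p) has_field_derivative of_nat p * g w ^ (p - 1) * deriv g w) (at w)"
    using DERIV_power[OF dg, of p] by (simp add: mult_ac)
  have "((\<lambda>x. g x ^ p) has_field_derivative of_nat q * (h w - c) ^ (q - 1) * deriv h w) (at w)"
    by (rule has_field_derivative_transform_within_open[OF d1 S]) (rule eq)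
  then have "of_nat q * (h w - c) ^ (q - 1) * deriv h w = of_nat p * g w ^ (p - 1) * deriv g w"
    using d2 by (rule DERIV_unique)
  from arg_cong[where f = cmod, OF this]
  have e: "real q * cmod (h w - c) ^ (q - 1) * cmod (deriv h w)
      = real p * cmod (g w) ^ (p - 1) * cmod (deriv g w)"
    by (simp add: norm_mult norm_power)
  define t where "t = cmod (g w)"
  have t: "t > 0" using nz by (simp add: t_def)
  have "cmod (h w - c) = t powr (real p / real q)"
    unfolding t_def using norm_of_root eq S by blast
  then have "cmod (h w - c) ^ (q - 1) = t powr (real p / real q * real (q - 1))"
    using t by (simp add: powr_powr flip: powr_realpow)
  moreover have "t ^ (p - 1) = t powr (real (p - 1))"
    using t by (simp add: powr_realpow)
  ultimately have e': "real q * t powr (real p / real q * real (q - 1)) * cmod (deriv h w)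
      = real p * t powr (real (p - 1)) * cmod (deriv g w)"
    using e by (simp add: t_def)
  have "real (p - 1) = real p / real q * real (q - 1) + (real p / real q - 1)"
    using q_pos p_pos by (simp add: field_simps of_nat_diff)
  then have "t powr (real (p - 1)) = t powr (real p / real q * real (q - 1)) * t powr (real p / real q - 1)"
    by (simp add: powr_add)
  with e' t q_pos show ?thesis
    by (simp add: speed_def t_def field_simps)
qed

lemma power_root_on_ball:
  assumes h: "h holomorphic_on ball x \<rho>" and nz: "\<And>w. w \<in> ball x \<rho> \<Longrightarrow> h w \<noteq> 0"
    and a: "a > 0" and y: "y ^ a = h x ^ b" and \<rho>: "\<rho> > 0"
  obtains g where "g holomorphic_on ball x \<rho>" "g x = y" "\<And>w. w \<in> ball x \<rho> \<Longrightarrow> g w ^ a = h w ^ b"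
proof -
  obtain L where L: "L holomorphic_on ball x \<rho>" "\<And>w. w \<in> ball x \<rho> \<Longrightarrow> h w = exp (L w)"
    using contractible_imp_holomorphic_log[OF h convex_imp_contractible nz] by (metis convex_ball)
  define E where "E w = exp (of_nat b * L w / of_nat a)" for w
  have E: "E w ^ a = h w ^ b" if "w \<in> ball x \<rho>" for w
  proof -
    have "E w ^ a = exp (of_nat a * (of_nat b * L w / of_nat a))"
      unfolding E_def by (rule exp_of_nat_mult[symmetric])
    also have "\<dots> = exp (of_nat b * L w)" using a by simp
    also have "\<dots> = h w ^ b" using L(2)[OF that] by (simp add: exp_of_nat_mult)
    finally show ?thesis .
  qed
  have x: "x \<in> ball x \<rho>" using \<rho> by simp
  have E0: "E x \<noteq> 0" by (simp add: E_def)
  show ?thesis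
  proof (rule that[of "\<lambda>w. y / E x * E w"])
    show "(\<lambda>w. y / E x * E w) holomorphic_on ball x \<rho>"
      unfolding E_def using L(1) a by (intro holomorphic_intros) auto
    show "y / E x * E x = y" using E0 by simp
    show "(y / E x * E w) ^ a = h w ^ b" if "w \<in> ball x \<rho>" for w
      using E[OF that] E[OF x] y nz[OF x] by (simp add: power_mult_distrib power_divide)
  qed
qed

section \<open>Continuity of roots\<close>

text \<open>As a set-valued map, \<open>z \<mapsto> z\<^bsup>p/q\<^esup>\<close> is Lipschitz on every disc around
\<open>0\<close>, branch point included: one continues the value along the segment from \<open>z\<close> to
\<open>z'\<close> and integrates the speed. If the segment passes through \<open>0\<close>, then
\<open>\<bar>z - z'\<bar> = \<bar>z\<bar> + \<bar>z'\<bar>\<close> and any value at \<open>z'\<close> is close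
enough.\<close>

lemma forward_lipschitz:
  fixes z z' v :: complex
  assumes v: "v ^ q = z ^ p" and z: "cmod z \<le> B" and z': "cmod z' \<le> B"
  obtains v' where "v' ^ q = z' ^ p" "cmod (v' - v) \<le> speed B * cmod (z' - z)"
proof -
  define \<beta> where "\<beta> = real p / real q"
  have \<beta>: "\<beta> > 1" using exponent_gt_1 by (simp add: \<beta>_def)
  have B: "B \<ge> 0" using z norm_ge_zero order_trans by blast
  have powr_le: "t powr \<beta> \<le> speed B * t" if "0 \<le> t" "t \<le> B" for t
  proof (cases "t = 0")
    case False
    then have "t powr \<beta> = 1 * t powr (\<beta> - 1) * t"
      using that powr_add[of t "\<beta> - 1" 1] by simp
    also have "\<dots> \<le> \<beta> * B powr (\<beta> - 1) * t"
      by (intro mult_mono powr_mono2) (use that \<beta> in auto)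
    finally show ?thesis by (simp add: speed_def \<beta>_def)
  qed simp
  note result = that
  have far: thesis if sum: "cmod z + cmod z' \<le> cmod (z' - z)"
  proof -
    obtain v' where v': "z' ^ p = v' ^ q"
      using exists_complex_root[of q "z' ^ p"] q_pos by auto
    have "cmod (v' - v) \<le> cmod v' + cmod v" by (rule norm_triangle_ineq4)
    also have "\<dots> \<le> speed B * cmod z' + speed B * cmod z"
      using powr_le[of "cmod z"] powr_le[of "cmod z'"] z z' norm_of_root[OF v] norm_of_root[OF v'[symmetric]]
      by (intro add_mono) (auto simp: \<beta>_def)
    also have "\<dots> \<le> speed B * cmod (z' - z)"
      using sum speed_nonneg[of B] by (metis add.commute distrib_left mult_left_mono)
    finally show thesis by (intro result[of v']) (simp_all add: v')
  qed
  show thesis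
  proof (cases "z = 0 \<or> z' / z \<in> \<real>\<^sub>\<le>\<^sub>0")
    case True
    have "cmod z + cmod z' \<le> cmod (z' - z)"
    proof (cases "z = 0")
      case False
      with True obtain t where t: "z' / z = complex_of_real t" "t \<le> 0"
        by (auto elim!: nonpos_Reals_cases)
      then have z't: "z' = complex_of_real t * z" using False by (simp add: field_simps)
      then have e: "z' - z = complex_of_real (t - 1) * z" by (simp add: algebra_simps)
      show ?thesis unfolding e unfolding z't norm_mult norm_of_real using t(2) by (simp add: algebra_simps)
    qed simp
    then show thesis by (rule far)
  next
    case False
    define u where "u = z' / z"
    have z0: "z \<noteq> 0" and u: "u \<notin> \<real>\<^sub>\<le>\<^sub>0" using False by (auto simp: u_def)
    \<comment> \<open>the segment from \<open>z\<close> to \<open>z'\<close> is rescaled to start at \<open>1\<close>, where the principal logarithm can be used\<close>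
    define G where "G \<zeta> = v * exp (of_real \<beta> * Ln \<zeta>)" for \<zeta>
    have seg: "closed_segment 1 u \<inter> \<real>\<^sub>\<le>\<^sub>0 = {}"
    proof (rule ccontr)
      assume "closed_segment 1 u \<inter> \<real>\<^sub>\<le>\<^sub>0 \<noteq> {}"
      then obtain x where "x \<in> closed_segment 1 u" "x \<in> \<real>\<^sub>\<le>\<^sub>0" by blast
      then obtain s where s: "0 \<le> s" "s \<le> 1" "x = (1 - s) *\<^sub>R 1 + s *\<^sub>R u" and x: "Re x \<le> 0" "Im x = 0"
        by (auto simp: closed_segment_def complex_nonpos_Reals_iff)
      have "s \<noteq> 0" using s x by auto
      then have "Im u = 0" using x(2) s by simp
      moreover have "Re u > 0" using u calculation by (auto simp: complex_nonpos_Reals_iff)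
      then have "Re x > 0" using s \<open>s \<noteq> 0\<close>
        by (simp add: add_nonneg_pos)
      ultimately show False using x by simp
    qed
    have "cmod (G u - G 1) \<le> (cmod z * speed B) * cmod (u - 1)"
    proof (rule field_differentiable_bound[where S = "closed_segment 1 u"
          and f' = "\<lambda>\<zeta>. v * (exp (of_real \<beta> * Ln \<zeta>) * (of_real \<beta> * inverse \<zeta>))"])
      fix \<zeta> assume \<zeta>: "\<zeta> \<in> closed_segment 1 u"
      then have n: "\<zeta> \<notin> \<real>\<^sub>\<le>\<^sub>0" using seg by blast
      then have \<zeta>0: "\<zeta> \<noteq> 0" by auto
      show "(G has_field_derivative v * (exp (of_real \<beta> * Ln \<zeta>) * (of_real \<beta> * inverse \<zeta>)))
              (at \<zeta> within closed_segment 1 u)"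
        unfolding G_def
        by (rule has_field_derivative_at_within) (use n in \<open>auto intro!: derivative_eq_intros simp: divide_inverse\<close>)
      have "\<zeta> * z \<in> closed_segment (1 * z) (u * z)"
      proof -
        obtain s where s: "0 \<le> s" "s \<le> 1" "\<zeta> = (1 - s) *\<^sub>R 1 + s *\<^sub>R u"
          using \<zeta> by (auto simp: closed_segment_def)
        have "\<zeta> * z = (1 - s) *\<^sub>R (1 * z) + s *\<^sub>R (u * z)"
          unfolding s(3) by (simp add: algebra_simps)
        then show ?thesis using s(1,2) unfolding closed_segment_def by blast
      qed
      then have "\<zeta> * z \<in> closed_segment z z'" using z0 by (simp add: u_def)
      moreover have "closed_segment z z' \<subseteq> cball 0 B"
        by (rule closed_segment_subset) (use z z' in auto)
      ultimately have \<zeta>z: "cmod \<zeta> * cmod z \<le> B" by (auto simp: norm_mult)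
      have "cmod (exp (of_real \<beta> * Ln \<zeta>)) = cmod \<zeta> powr \<beta>"
        using \<zeta>0 by (simp add: powr_def)
      then have "cmod (v * (exp (of_real \<beta> * Ln \<zeta>) * (of_real \<beta> * inverse \<zeta>)))
          = cmod z powr \<beta> * (cmod \<zeta> powr \<beta> * (\<beta> / cmod \<zeta>))"
        using norm_of_root[OF v] \<beta> by (simp add: norm_mult norm_inverse \<beta>_def divide_inverse)
      also have "\<dots> = cmod z * (\<beta> * (cmod \<zeta> * cmod z) powr (\<beta> - 1))"
        using \<zeta>0 z0 by (simp add: powr_mult powr_diff field_simps)
      also have "\<dots> \<le> cmod z * (\<beta> * B powr (\<beta> - 1))"
        using \<zeta>z \<beta> by (intro mult_left_mono powr_mono2) auto
      finally show "cmod (v * (exp (of_real \<beta> * Ln \<zeta>) * (of_real \<beta> * inverse \<zeta>))) \<le> cmod z * speed B"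
        by (simp add: speed_def \<beta>_def)
    qed auto
    also have "\<dots> = speed B * cmod (z * (u - 1))"
      by (simp add: norm_mult)
    also have "z * (u - 1) = z' - z"
      using z0 by (simp add: u_def field_simps)
    finally have 1: "cmod (G u - v) \<le> speed B * cmod (z' - z)" by (simp add: G_def)
    have u0: "u \<noteq> 0" using u by auto
    have "exp (of_real \<beta> * Ln u) ^ q = exp (of_nat q * (of_real \<beta> * Ln u))"
      by (rule exp_of_nat_mult[symmetric])
    also have "of_nat q * (of_real \<beta> * Ln u) = of_nat p * Ln u"
      using q_pos by (simp add: \<beta>_def)
    also have "exp (of_nat p * Ln u) = u ^ p"
      using u0 by (simp add: exp_of_nat_mult)
    finally have "G u ^ q = z ^ p * u ^ p"
      by (simp add: G_def power_mult_distrib v)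
    then have "G u ^ q = z' ^ p" using z0 by (simp add: u_def flip: power_mult_distrib)
    then show thesis using that 1 by blast
  qed
qed

text \<open>The product of the distances of \<open>z\<close> to all \<open>n\<close>-th roots of \<open>A\<close> is
\<open>\<bar>z\<^sup>n - A\<bar>\<close>, so the smallest distance obeys this bound.\<close>

lemma nearest_root:
  fixes z A :: complex
  assumes "n > 0"
  obtains z' where "z' ^ n = A" "cmod (z' - z) ^ n \<le> cmod (z ^ n - A)"
proof -
  define P where "P = monom 1 n + [:- A:]"
  have dP: "degree P = n" "lead_coeff P = 1"
  proof -
    show "degree P = n"
      unfolding P_def using assms by (subst degree_add_eq_left) (auto simp: degree_monom_eq)
    then show "lead_coeff P = 1"
      using assms coeff_pCons_Suc[of "- A" 0 "n - 1"] by (simp add: P_def)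
  qed
  then have P0: "P \<noteq> 0" using assms by auto
  obtain X where X: "size X = n" "P = (\<Prod>x\<in>#X. [:-x, 1:])"
  proof (rule that[of "proots P"])
    show "size (proots P) = n" using size_proots_complex[of P] dP(1) by simp
    show "P = (\<Prod>x\<in>#proots P. [:-x, 1:])"
      using complex_poly_decompose_multiset[of P] unfolding dP(2) by simp
  qed
  have ev: "poly P w = (\<Prod>x\<in>#X. w - x)" for w
    unfolding X(2) by (simp add: poly_prod_mset image_mset.compositionality comp_def)
  have evP: "poly P w = w ^ n - A" for w by (simp add: P_def poly_monom)
  have ex: "\<exists>x\<in>#Y. cmod (x - z) ^ size Y \<le> cmod (\<Prod>x\<in>#Y. z - x)" if "Y \<noteq> {#}" for Y
  proof -
    define x where "x = arg_min_on (\<lambda>y. cmod (y - z)) (set_mset Y)"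
    have x: "x \<in># Y" "\<forall>y\<in>#Y. cmod (x - z) \<le> cmod (y - z)"
      unfolding x_def using that by (auto intro!: arg_min_if_finite(1) arg_min_least)
    have "cmod (x - z) ^ size Z \<le> cmod (\<Prod>x\<in>#Z. z - x)" if "Z \<subseteq># Y" for Z
      using that
    proof (induction Z)
      case (add y Z)
      then have "y \<in># Y" "Z \<subseteq># Y" by (auto dest: mset_subset_eq_insertD subset_mset.less_imp_le)
      then show ?case using add.IH x(2)
        by (auto simp: norm_mult norm_minus_commute intro!: mult_mono)
    qed simp
    then show ?thesis using x by blast
  qed
  have "X \<noteq> {#}" using X(1) assms by auto
  from ex[OF this] obtain x where x: "x \<in># X" "cmod (x - z) ^ n \<le> cmod (z ^ n - A)"
    using ev[of z] evP[of z] X(1) by auto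
  have "poly P x = 0" unfolding ev using x(1) by (auto simp: prod_mset_zero_iff)
  then show thesis using that x(2) evP[of x] by simp
qed


section \<open>Finite orbits\<close>

definition path :: "complex \<Rightarrow> nat \<Rightarrow> (nat \<Rightarrow> complex) \<Rightarrow> bool" where
  "path c N Y \<longleftrightarrow> (\<forall>i<N. (Y (Suc i) - c) ^ q = Y i ^ p)"

lemma forward_orbit_iff: "forward_orbit p q c z \<longleftrightarrow> (\<forall>i. (z (Suc i) - c) ^ q = z i ^ p)"
  by (simp add: forward_orbit_def corr_def)

lemma forward_orbit_path: "forward_orbit p q c z \<Longrightarrow> path c N (\<lambda>i. z (k + i))"
  by (simp add: forward_orbit_iff path_def)

lemma path_Cons:
  assumes "path c N Y" "(Y 0 - c) ^ q = x ^ p"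
  shows "path c (Suc N) (case_nat x Y)"
  using assms by (auto simp: path_def less_Suc_eq_0_disj split: nat.split)

lemma path_Suc_iff:
  "path c (Suc N) Y \<longleftrightarrow> (Y 1 - c) ^ q = Y 0 ^ p \<and> path c N (\<lambda>i. Y (Suc i))"
  by (auto simp: path_def less_Suc_eq_0_disj)

lemma path_append:
  assumes "path c M X" "path c N Y" "X M = Y 0"
  shows "path c (M + N) (\<lambda>i. if i \<le> M then X i else Y (i - M))"
  unfolding path_def
proof (intro allI impI)
  fix i assume i: "i < M + N"
  consider "i < M" | "i = M" | "i > M" by linarith
  then show "((if Suc i \<le> M then X (Suc i) else Y (Suc i - M)) - c) ^ q
      = (if i \<le> M then X i else Y (i - M)) ^ p"
  proof cases
    case 3
    then show ?thesis using assms(2) i unfolding path_def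
      by (simp add: Suc_diff_le less_imp_le)
  qed (use assms i in \<open>auto simp: path_def\<close>)
qed

lemma cycle_of_path:
  assumes Y: "path c N Y" and cl: "Y N = Y 0" and N: "N > 0"
  shows "corr_cycle p q c N (\<lambda>i. Y (i mod N))"
  unfolding corr_cycle_def forward_orbit_iff
proof (intro conjI allI)
  fix i
  have "Y (Suc i mod N) = Y (Suc (i mod N))"
    using N cl by (simp add: mod_Suc)
  then show "(Y (Suc i mod N) - c) ^ q = Y (i mod N) ^ p"
    using Y N by (simp add: path_def)
qed (use N in auto)

lemma cycle_shift: "corr_cycle p q c n z \<Longrightarrow> corr_cycle p q c n (\<lambda>i. z (k + i))"
  by (simp add: corr_cycle_def forward_orbit_iff flip: add.assoc)

lemma cycle_add_mult:
  assumes "corr_cycle p q c n z"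
  shows "z (i + k * n) = z i"
proof (induction k)
  case (Suc k)
  have "z (i + k * n + n) = z (i + k * n)"
    using assms by (simp add: corr_cycle_def)
  then show ?case using Suc by (simp add: algebra_simps)
qed simp

lemma cycle_range:
  assumes "corr_cycle p q c n z"
  shows "range z = z ` {..<n}"
proof -
  have "z i = z (i mod n)" for i
    using cycle_add_mult[OF assms, of "i mod n" "i div n"] by simp
  moreover have "i mod n \<in> {..<n}" for i using assms by (simp add: corr_cycle_def)
  ultimately show ?thesis by blast
qed

lemma cycle_bounded: "corr_cycle p q c n z \<Longrightarrow> bounded (range z)"
  by (simp add: cycle_range finite_imp_bounded)

lemma prod_over_periods:
  fixes F :: "nat \<Rightarrow> real"
  assumes "\<And>i k. F (i + k * n) = F i"
  shows "(\<Prod>i<k * n. F i) = (\<Prod>i<n. F i) ^ k"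
proof (induction k)
  case (Suc k)
  have "(\<Prod>i<k * n + m. F i) = (\<Prod>i<k * n. F i) * (\<Prod>i<m. F i)" for m
    by (induction m) (use assms in \<open>auto simp: add.commute\<close>)
  from this[of n] show ?case using Suc by (simp add: add.commute mult.commute)
qed simp

text \<open>Outside a large disc the correspondence increases the modulus by more than \<open>1\<close>, since \<open>p >
q\<close>. Hence the disc is backward invariant and contains all bounded orbits.\<close>

lemma escape_step:
  assumes R: "2 ^ q < R" "cmod c + 1 \<le> R" and z: "R \<le> cmod z" and w: "(w - c) ^ q = z ^ p"
  shows "cmod z + 1 < cmod w"
proof (rule ccontr)
  assume "\<not> cmod z + 1 < cmod w"
  then have "cmod (w - c) \<le> 2 * cmod z"
    using norm_triangle_ineq4[of w c] R z by linarith
  then have "cmod (w - c) ^ q \<le> (2 * cmod z) ^ q" by (rule power_mono) simp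
  also have "\<dots> = 2 ^ q * cmod z ^ q" by (simp add: power_mult_distrib)
  also have "\<dots> < cmod z * cmod z ^ q"
  proof (rule mult_strict_right_mono)
    show "2 ^ q < cmod z" using R z by simp
    then have "0 < cmod z" by (rule order.strict_trans1[rotated]) simp
    then show "0 < cmod z ^ q" by simp
  qed
  also have "\<dots> = cmod z ^ Suc q" by simp
  also have "\<dots> \<le> cmod z ^ p"
    using R z q_less_p one_le_power[of "2::real" q] by (intro power_increasing) linarith+
  finally have "cmod (w - c) ^ q < cmod z ^ p" .
  then show False using w by (metis norm_power less_irrefl)
qed

lemma bounded_orbit_in_ball:
  assumes R: "2 ^ q < R" "cmod c + 1 \<le> R" and z: "forward_orbit p q c z" "bounded (range z)"
  shows "cmod (z i) < R"
proof (rule ccontr)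
  assume "\<not> cmod (z i) < R"
  then have *: "R \<le> cmod (z i)" by simp
  have **: "cmod (z i) + real k \<le> cmod (z (i + k))" for k
  proof (induction k)
    case (Suc k)
    have "cmod (z (i + k)) + 1 < cmod (z (Suc (i + k)))"
      by (rule escape_step[OF R]) (use z(1) Suc * in \<open>auto simp: forward_orbit_iff\<close>)
    with Suc show ?case by simp
  qed simp
  obtain b where b: "\<And>i. cmod (z i) \<le> b" using z(2) by (auto simp: bounded_iff)
  obtain k where "real k > b" using reals_Archimedean2 by blast
  then show False using **[of k] b[of "i + k"] norm_ge_zero[of "z i"] by linarith
qed

text \<open>\<open>f\<^sub>c\<close> is a translate of \<open>f\<^sub>0\<close>, so changing the parameter amounts to moving the image point, and
  a preimage moves little because roots of a number depend continuously on it, even at \<open>0\<close>.\<close>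

lemma preimage_tracking:
  assumes "\<epsilon> > 0"
  obtains \<kappa> where "\<kappa> > 0" "\<And>c c' z w w'. (w - c) ^ q = z ^ p \<Longrightarrow> cmod (w - c) \<le> R \<Longrightarrow> cmod (w' - c') \<le> R
      \<Longrightarrow> cmod ((w' - c') - (w - c)) < \<kappa> \<Longrightarrow> \<exists>z'. (w' - c') ^ q = z' ^ p \<and> cmod (z' - z) < \<epsilon>"
proof -
  have "uniformly_continuous_on (cball 0 R) (\<lambda>u::complex. u ^ q)"
    by (intro compact_uniformly_continuous continuous_intros) auto
  then obtain \<kappa> where \<kappa>: "\<kappa> > 0"
    "\<And>u u'::complex. u \<in> cball 0 R \<Longrightarrow> u' \<in> cball 0 R \<Longrightarrow> dist u' u < \<kappa> \<Longrightarrow> dist (u' ^ q) (u ^ q) < \<epsilon> ^ p"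
    unfolding uniformly_continuous_on_def using assms by (metis zero_less_power)
  show thesis
  proof (rule that[OF \<kappa>(1)])
    fix c c' z w w' :: complex
    assume *: "(w - c) ^ q = z ^ p" "cmod (w - c) \<le> R" "cmod (w' - c') \<le> R" "cmod ((w' - c') - (w - c)) < \<kappa>"
    have "cmod ((w' - c') ^ q - (w - c) ^ q) < \<epsilon> ^ p"
      using \<kappa>(2)[of "w - c" "w' - c'"] * by (simp add: dist_norm norm_minus_commute)
    moreover obtain z' where z': "z' ^ p = (w' - c') ^ q" "cmod (z' - z) ^ p \<le> cmod (z ^ p - (w' - c') ^ q)"
      using nearest_root p_pos by blast
    ultimately have "cmod (z' - z) ^ p < \<epsilon> ^ p"
      using *(1) by (simp add: norm_minus_commute)
    then show "\<exists>z'. (w' - c') ^ q = z' ^ p \<and> cmod (z' - z) < \<epsilon>"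
      using z'(1) power_less_imp_less_base assms by (metis less_imp_le)
  qed
qed

text \<open>Over a bounded number of steps, an orbit of \<open>c\<close> is followed by an orbit of \<open>c'\<close> with
the same endpoint. It is built backwards from there by choosing nearest preimages; since roots are
not Lipschitz near \<open>0\<close>, the admissible \<open>\<kappa>\<close> depends on the number of steps.\<close>

lemma backward_tracking:
  assumes "\<epsilon> > 0"
  shows "\<exists>\<kappa>>0. \<forall>c c' Y. cmod c \<le> R \<longrightarrow> cmod c' \<le> R \<longrightarrow> cmod (c' - c) < \<kappa> \<longrightarrow> path c N Y
      \<longrightarrow> (\<forall>i\<le>N. cmod (Y i) \<le> R) \<longrightarrow> (\<exists>Y'. path c' N Y' \<and> Y' N = Y N \<and> cmod (Y' 0 - Y 0) < \<epsilon>)"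
  using assms
proof (induction N arbitrary: \<epsilon>)
  case 0
  then show ?case by (intro exI[of _ 1]) (auto simp: path_def)
next
  case (Suc N)
  obtain \<kappa>1 where \<kappa>1: "\<kappa>1 > 0" "\<And>c c' z w w'. (w - c) ^ q = z ^ p \<Longrightarrow> cmod (w - c) \<le> 2 * R + 1 \<Longrightarrow> cmod (w' - c') \<le> 2 * R + 1
      \<Longrightarrow> cmod ((w' - c') - (w - c)) < \<kappa>1 \<Longrightarrow> \<exists>z'. (w' - c') ^ q = z' ^ p \<and> cmod (z' - z) < \<epsilon>"
    using preimage_tracking[OF Suc.prems, of "2 * R + 1"] by blast
  define e where "e = min 1 (\<kappa>1 / 2)"
  have e: "e > 0" "e \<le> 1" "e \<le> \<kappa>1 / 2" using \<kappa>1(1) by (auto simp: e_def)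
  obtain \<kappa>2 where \<kappa>2: "\<kappa>2 > 0" "\<And>c c' Y. cmod c \<le> R \<Longrightarrow> cmod c' \<le> R \<Longrightarrow> cmod (c' - c) < \<kappa>2 \<Longrightarrow> path c N Y
      \<Longrightarrow> (\<And>i. i \<le> N \<Longrightarrow> cmod (Y i) \<le> R) \<Longrightarrow> (\<exists>Y'. path c' N Y' \<and> Y' N = Y N \<and> cmod (Y' 0 - Y 0) < e)"
    using Suc.IH[OF e(1)] by blast
  show ?case
  proof (intro exI[of _ "min \<kappa>2 (\<kappa>1 / 2)"] conjI allI impI)
    fix c c' Y
    assume c: "cmod c \<le> R" "cmod c' \<le> R" "cmod (c' - c) < min \<kappa>2 (\<kappa>1 / 2)"
      and Y: "path c (Suc N) Y" "\<forall>i\<le>Suc N. cmod (Y i) \<le> R"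
    have Y1: "(Y 1 - c) ^ q = Y 0 ^ p" and Yt: "path c N (\<lambda>i. Y (Suc i))"
      using Y(1) unfolding path_Suc_iff by auto
    obtain X where X: "path c' N X" "X N = Y (Suc N)" "cmod (X 0 - Y 1) < e"
      using \<kappa>2(2)[OF c(1,2) _ Yt] c(3) Y(2) by auto
    have "cmod (Y 1) \<le> R" using Y(2) by simp
    then have b: "cmod (Y 1 - c) \<le> 2 * R + 1" "cmod (X 0 - c') \<le> 2 * R + 1"
      using norm_triangle_ineq4[of "Y 1" c] norm_triangle_ineq4[of "X 0" c'] norm_triangle_ineq[of "X 0 - Y 1" "Y 1"]
        c X(3) e by auto
    have "cmod ((X 0 - c') - (Y 1 - c)) < \<kappa>1"
      using norm_triangle_ineq4[of "X 0 - Y 1" "c' - c"] X(3) e c(3) by (simp add: algebra_simps)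
    from \<kappa>1(2)[OF Y1 b this]
    obtain x where x: "(X 0 - c') ^ q = x ^ p" "cmod (x - Y 0) < \<epsilon>" by blast
    show "\<exists>Y'. path c' (Suc N) Y' \<and> Y' (Suc N) = Y (Suc N) \<and> cmod (Y' 0 - Y 0) < \<epsilon>"
      using path_Cons[OF X(1) x(1)] x(2) X(2) by (intro exI[of _ "case_nat x X"]) simp
  qed (use \<kappa>1 \<kappa>2 in auto)
qed

section \<open>Expansion on a backward invariant set\<close>

text \<open>The parameter \<open>\<delta>\<close> is the distance that preimages of \<open>U\<close> keep from the
complement, uniformly for \<open>c \<in> W\<close>. Since \<open>0\<close> is the preimage of
\<open>c\<close>, the condition \<open>0 \<notin> U\<close> forces \<open>c \<notin> U\<close>, so preimages
in \<open>U\<close> can be continued holomorphically.\<close>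

definition repeller :: "complex set \<Rightarrow> complex set \<Rightarrow> real \<Rightarrow> real \<Rightarrow> bool" where
  "repeller W U R \<delta> \<longleftrightarrow> open U \<and> U \<subseteq> ball 0 R \<and> W \<subseteq> cball 0 R \<and> 0 \<notin> U \<and> 0 < \<delta> \<and> 
     (\<forall>c\<in>W. \<forall>z w. w \<in> U \<longrightarrow> (w - c) ^ q = z ^ p \<longrightarrow> ball z \<delta> \<subseteq> U)"

context
  fixes W U R \<delta>
  assumes rep: "repeller W U R \<delta>"
begin

lemma repeller_facts:
  shows "open U" "U \<subseteq> ball 0 R" "0 \<notin> U" "0 < \<delta>"
    and "\<And>c z w. c \<in> W \<Longrightarrow> w \<in> U \<Longrightarrow> (w - c) ^ q = z ^ p \<Longrightarrow> ball z \<delta> \<subseteq> U"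
    and "\<And>c z w. c \<in> W \<Longrightarrow> w \<in> U \<Longrightarrow> (w - c) ^ q = z ^ p \<Longrightarrow> z \<in> U"
    and "\<And>c. c \<in> W \<Longrightarrow> c \<notin> U"
    and "\<And>c. c \<in> W \<Longrightarrow> cmod c \<le> R"
proof -
  show 1: "open U" "U \<subseteq> ball 0 R" "0 \<notin> U" "0 < \<delta>"
    and 2: "\<And>c z w. c \<in> W \<Longrightarrow> w \<in> U \<Longrightarrow> (w - c) ^ q = z ^ p \<Longrightarrow> ball z \<delta> \<subseteq> U"
    using rep by (auto simp: repeller_def)
  show 3: "\<And>c z w. c \<in> W \<Longrightarrow> w \<in> U \<Longrightarrow> (w - c) ^ q = z ^ p \<Longrightarrow> z \<in> U"
    using 2 1(4) by (meson centre_in_ball subsetD)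
  show "\<And>c. c \<in> W \<Longrightarrow> c \<notin> U"
  proof
    fix c assume "c \<in> W" "c \<in> U"
    then have "0 \<in> U" using 3[of c c 0] q_pos p_pos by (simp add: power_0_left)
    then show False using 1 by blast
  qed
  show "\<And>c. c \<in> W \<Longrightarrow> cmod c \<le> R" using rep by (auto simp: repeller_def)
qed

lemma path_in_repeller:
  assumes c: "c \<in> W" and Y: "path c N Y" and "Y N \<in> U" "i \<le> N"
  shows "Y i \<in> U"
  using assms(4)
proof (induction "N - i" arbitrary: i)
  case 0
  then show ?case using assms(3) by simp
next
  case (Suc k)
  then have "Y (Suc i) \<in> U" by simp
  moreover have "(Y (Suc i) - c) ^ q = Y i ^ p" using Y Suc by (simp add: path_def)
  ultimately show ?case using repeller_facts(6)[OF c] by blast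
qed

text \<open>Each point of a cycle is an iterated preimage of every other one, so backward invariance captures the whole
cycle.\<close>

lemma cycle_in_repeller:
  assumes c: "c \<in> W" and z: "corr_cycle p q c n z" and "z k \<in> U"
  shows "range z \<subseteq> U"
proof
  fix x assume "x \<in> range z"
  then obtain i where x: "x = z i" by blast
  have n: "n > 0" using z by (simp add: corr_cycle_def)
  define N where "N = k + i * n"
  have "i \<le> N" using n by (simp add: N_def trans_le_add2)
  have "path c N z" using z by (simp add: path_def corr_cycle_def forward_orbit_iff)
  moreover have "z N \<in> U" unfolding N_def using cycle_add_mult[OF z] assms(3) by simp
  ultimately show "x \<in> U" unfolding x using path_in_repeller[OF c] \<open>i \<le> N\<close> by blast
qed

lemma preimage_lift:
  assumes c: "c \<in> W" and \<rho>: "\<rho> > 0" and h: "h holomorphic_on ball x \<rho>" "h ` ball x \<rho> \<subseteq> U"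
    and y: "(h x - c) ^ q = y ^ p"
  obtains g where "g holomorphic_on ball x \<rho>" "g x = y"
    "\<And>w. w \<in> ball x \<rho> \<Longrightarrow> (h w - c) ^ q = g w ^ p"
    "\<And>w. w \<in> ball x \<rho> \<Longrightarrow> ball (g w) \<delta> \<subseteq> U"
    "\<And>w. w \<in> ball x \<rho> \<Longrightarrow> g w \<in> U"
    "\<And>w. w \<in> ball x \<rho> \<Longrightarrow> cmod (deriv h w) = speed (cmod (g w)) * cmod (deriv g w)"
proof -
  have nz: "h w - c \<noteq> 0" if "w \<in> ball x \<rho>" for w
    using repeller_facts(7)[OF c] h(2) that by (metis eq_iff_diff_eq_0 image_subset_iff)
  obtain g where g: "g holomorphic_on ball x \<rho>" "g x = y" "\<And>w. w \<in> ball x \<rho> \<Longrightarrow> g w ^ p = (h w - c) ^ q"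
    by (rule power_root_on_ball[of "\<lambda>w. h w - c" x \<rho> p y q])
      (use h nz p_pos y \<rho> in \<open>auto intro!: holomorphic_intros\<close>)
  have gU: "g w \<in> U" if "w \<in> ball x \<rho>" for w
    by (rule repeller_facts(6)[OF c, of "h w"]) (use h(2) that g(3) in auto)
  show thesis
  proof (rule that[OF g(1,2)])
    show "ball (g w) \<delta> \<subseteq> U" if "w \<in> ball x \<rho>" for w
      by (rule repeller_facts(5)[OF c, of "h w"]) (use h(2) that g(3) in auto)
    show "cmod (deriv h w) = speed (cmod (g w)) * cmod (deriv g w)" if "w \<in> ball x \<rho>" for w
      by (rule deriv_of_branch[where S = "ball x \<rho>" and c = c])
        (use h(1) that g gU[OF that] repeller_facts(3) in auto)
  qed (use g gU in auto)
qed

lemma deriv_bound: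
  assumes "h holomorphic_on ball 0 1" "h ` ball 0 1 \<subseteq> U"
  shows "cmod (deriv h 0) \<le> R"
proof (rule field_le_mult_one_interval)
  fix s :: real assume s: "0 < s" "s < 1"
  have "cball (0::complex) s \<subseteq> ball 0 1" using s by auto
  then have 1: "continuous_on (cball 0 s) h"
    using holomorphic_on_imp_continuous_on[OF assms(1)] continuous_on_subset by blast
  have 2: "h holomorphic_on ball 0 s"
    using assms(1) s by (auto elim!: holomorphic_on_subset)
  have "cmod ((deriv ^^ 1) h 0) \<le> fact 1 * R / s ^ 1"
  proof (rule Cauchy_higher_deriv_bound[OF 2 1, where y = 0])
    show "h w \<in> ball 0 R" if "w \<in> ball 0 s" for w
    proof -
      have "w \<in> ball 0 1" using that s by simp
      then show ?thesis using assms(2) repeller_facts(2) by blast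
    qed
  qed (use s in auto)
  then show "s * cmod (deriv h 0) \<le> R" using s by (simp add: field_simps)
qed

text \<open>A lifted disc has derivative at most \<open>R\<close> at its centre. Its derivative may be enlarged by the
factor \<open>1 + \<eta>\<close> as long as \<open>\<eta> R \<le> \<delta>\<close>; the value \<open>\<eta> =
\<delta> / (2 (R + \<delta>))\<close> is one such choice.\<close>

definition gain :: real where "gain = 1 + \<delta> / (2 * (R + \<delta>))"

text \<open>Lifting multiplies the derivative at the centre by the reciprocal of the speed, and enlarging the lifted disc
within its \<open>\<delta>\<close>-margin contributes one more factor \<open>gain\<close> per step.\<close>

lemma expanding_disc:
  assumes c: "c \<in> W" and Y: "path c N Y" and r: "r > 0" "ball (Y N) r \<subseteq> U"
  shows "\<exists>h. h holomorphic_on ball 0 1 \<and> h ` ball 0 1 \<subseteq> U \<and> h 0 = Y 0 \<and>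
     cmod (deriv h 0) * (\<Prod>i<N. speed (cmod (Y i))) = r * gain ^ N"
  using Y r(2)
proof (induction N arbitrary: Y)
  case 0
  define h where "h \<zeta> = Y 0 + of_real r * \<zeta>" for \<zeta>
  have "h ` ball 0 1 \<subseteq> ball (Y 0) r"
    using r(1) by (auto simp: h_def dist_norm norm_mult)
  moreover have "deriv h 0 = of_real r" unfolding h_def
    by (rule DERIV_imp_deriv) (auto intro!: derivative_eq_intros)
  moreover have "h holomorphic_on ball 0 1" unfolding h_def by (intro holomorphic_intros)
  moreover have "h 0 = Y 0" by (simp add: h_def)
  ultimately show ?case using 0 r(1) by (intro exI[of _ h]) auto
next
  case (Suc N)
  have Y1: "(Y 1 - c) ^ q = Y 0 ^ p" and Yt: "path c N (\<lambda>i. Y (Suc i))"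
    using Suc.prems unfolding path_Suc_iff by auto
  obtain h where h: "h holomorphic_on ball 0 1" "h ` ball 0 1 \<subseteq> U" "h 0 = Y 1"
    "cmod (deriv h 0) * (\<Prod>i<N. speed (cmod (Y (Suc i)))) = r * gain ^ N"
    using Suc.IH[OF Yt] Suc.prems by auto
  obtain g where g: "g holomorphic_on ball 0 1" "g 0 = Y 0"
    "\<And>w. w \<in> ball 0 1 \<Longrightarrow> ball (g w) \<delta> \<subseteq> U" "\<And>w. w \<in> ball 0 1 \<Longrightarrow> g w \<in> U"
    "\<And>w. w \<in> ball 0 1 \<Longrightarrow> cmod (deriv h w) = speed (cmod (g w)) * cmod (deriv g w)"
    by (rule preimage_lift[OF c, of 1 h 0 "Y 0"]) (use h Y1 in auto)
  have dg: "cmod (deriv g 0) \<le> R" by (rule deriv_bound) (use g in auto)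
  then have R: "R \<ge> 0" using norm_ge_zero order_trans by blast
  have \<delta>: "\<delta> > 0" by (rule repeller_facts)
  define \<eta> where "\<eta> = \<delta> / (2 * (R + \<delta>))"
  have \<eta>: "\<eta> > 0" "\<eta> * R \<le> \<delta>" "gain = 1 + \<eta>"
    using R \<delta> by (auto simp: \<eta>_def gain_def field_simps)
  \<comment> \<open>the enlarged disc: same centre, derivative multiplied by \<open>1 + \<eta>\<close>\<close>
  define k where "k \<zeta> = g \<zeta> + of_real \<eta> * deriv g 0 * \<zeta>" for \<zeta>
  have "(g has_field_derivative deriv g 0) (at 0)"
    using g(1) by (rule holomorphic_derivI) auto
  then have "(k has_field_derivative deriv g 0 + of_real \<eta> * deriv g 0) (at 0)"
    unfolding k_def by (auto intro!: derivative_eq_intros)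
  then have "deriv k 0 = of_real (1 + \<eta>) * deriv g 0"
    by (auto dest!: DERIV_imp_deriv simp: algebra_simps)
  then have dk: "cmod (deriv k 0) = gain * cmod (deriv g 0)"
    using \<eta> by (simp only: norm_mult norm_of_real)
  have "k \<zeta> \<in> U" if \<zeta>: "\<zeta> \<in> ball 0 1" for \<zeta>
  proof -
    have "cmod (k \<zeta> - g \<zeta>) = (\<eta> * cmod (deriv g 0)) * cmod \<zeta>"
      using \<eta> by (simp add: k_def norm_mult)
    also have "\<dots> \<le> \<delta> * cmod \<zeta>"
      using \<eta> dg by (intro mult_right_mono) (auto intro: order_trans[OF mult_left_mono])
    also have "\<dots> < \<delta>" using \<delta> \<zeta> by simp
    finally have "k \<zeta> \<in> ball (g \<zeta>) \<delta>" by (simp add: dist_norm norm_minus_commute)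
    then show ?thesis using g(3)[OF \<zeta>] by blast
  qed
  moreover have "k holomorphic_on ball 0 1"
    unfolding k_def using g(1) by (intro holomorphic_intros)
  moreover have "cmod (deriv k 0) * (\<Prod>i<Suc N. speed (cmod (Y i))) = r * gain ^ Suc N"
  proof -
    have "cmod (deriv k 0) * (\<Prod>i<Suc N. speed (cmod (Y i)))
        = gain * ((speed (cmod (Y 0)) * cmod (deriv g 0)) * (\<Prod>i<N. speed (cmod (Y (Suc i)))))"
      unfolding dk prod.lessThan_Suc_shift by (simp add: mult_ac)
    also have "speed (cmod (Y 0)) * cmod (deriv g 0) = cmod (deriv h 0)"
      using g(5)[of 0] g(2) by simp
    finally show ?thesis using h(4) by simp
  qed
  moreover have "k 0 = Y 0" by (simp add: k_def g(2))
  ultimately show ?case by (intro exI[of _ k]) blast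
qed

lemma gain_gt_1:
  assumes "U \<noteq> {}" shows "gain > 1"
proof -
  have "R > 0" using assms repeller_facts(2) by (metis ball_empty linorder_not_less subset_empty)
  then show ?thesis using repeller_facts(4) by (simp add: gain_def)
qed

text \<open>Cauchy's estimate for the disc just constructed: the orbit is expanded exponentially, up to the constant
\<open>r / R\<close>.\<close>

lemma expansion:
  assumes c: "c \<in> W" and Y: "path c N Y" and r: "r > 0" "ball (Y N) r \<subseteq> U"
  shows "r * gain ^ N \<le> R * (\<Prod>i<N. speed (cmod (Y i)))"
proof -
  obtain h where h: "h holomorphic_on ball 0 1" "h ` ball 0 1 \<subseteq> U"
     "cmod (deriv h 0) * (\<Prod>i<N. speed (cmod (Y i))) = r * gain ^ N"
    using expanding_disc[OF assms] by blast
  show ?thesis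
    unfolding h(3)[symmetric] by (intro mult_right_mono deriv_bound[OF h(1,2)] prod_nonneg) (simp add: speed_nonneg)
qed

text \<open>Running around the cycle many times makes the constant \<open>r / R\<close> in the expansion estimate
irrelevant.\<close>

lemma cycle_speed_gt_1:
  assumes c: "c \<in> W" and z: "corr_cycle p q c n z" and U: "range z \<subseteq> U"
  shows "(\<Prod>i<n. speed (cmod (z i))) > 1"
proof (rule ccontr)
  assume "\<not> ?thesis"
  then have le: "(\<Prod>i<n. speed (cmod (z i))) \<le> 1" by simp
  obtain r where r: "r > 0" "ball (z 0) r \<subseteq> U"
    using repeller_facts(1) U by (meson openE range_subsetD)
  have n: "n > 0" using z by (simp add: corr_cycle_def)
  have pr: "(\<Prod>i<k * n. speed (cmod (z i))) = (\<Prod>i<n. speed (cmod (z i))) ^ k" for k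
    by (rule prod_over_periods) (simp add: cycle_add_mult[OF z])
  have gn: "gain ^ n > 1" using gain_gt_1 U n by (auto intro!: one_less_power)
  obtain k where k: "R / r < (gain ^ n) ^ k" using real_arch_pow[OF gn] by blast
  have "r * gain ^ (k * n) \<le> R * (\<Prod>i<k * n. speed (cmod (z i)))"
  proof (rule expansion[OF c _ r(1)])
    show "path c (k * n) z" using z by (simp add: path_def corr_cycle_def forward_orbit_iff)
    show "ball (z (k * n)) r \<subseteq> U" using r cycle_add_mult[OF z, of 0 k] by simp
  qed
  also have "\<dots> \<le> R * 1"
  proof (intro mult_left_mono)
    show "(\<Prod>i<k * n. speed (cmod (z i))) \<le> 1"
      unfolding pr using le by (intro power_le_one prod_nonneg) (auto simp: speed_nonneg)
    have "z 0 \<in> ball 0 R" using U repeller_facts(2) by blast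
    then show "0 \<le> R" by (simp add: order.strict_implies_order[OF order.strict_trans1[OF norm_ge_zero]])
  qed
  finally have "(gain ^ n) ^ k \<le> R / r"
    using r by (simp add: field_simps power_mult[symmetric])
  then show False using k by simp
qed

text \<open>The orbits are carried along with the branch: each value \<open>G w\<close> starts an orbit that ends at
\<open>w\<close>, and its speeds determine the derivative of \<open>G\<close>.\<close>

lemma inverse_branch_along_path:
  assumes c: "c \<in> W" and Y: "path c N Y" and r: "r > 0" "ball (Y N) r \<subseteq> U"
  shows "\<exists>G. G holomorphic_on ball (Y N) r \<and> G (Y N) = Y 0 \<and>
    (\<forall>w\<in>ball (Y N) r. \<exists>X. path c N X \<and> X 0 = G w \<and> X N = w \<and>
       cmod (deriv G w) * (\<Prod>i<N. speed (cmod (X i))) = 1)"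
  using Y r(2)
proof (induction N arbitrary: Y)
  case 0
  have "deriv (\<lambda>x. x) w = 1" for w :: complex by simp
  then show ?case by (intro exI[of _ "\<lambda>w. w"]) (auto simp: path_def intro!: exI[of _ "\<lambda>_. w" for w])
next
  case (Suc N)
  have Y1: "(Y 1 - c) ^ q = Y 0 ^ p" and Yt: "path c N (\<lambda>i. Y (Suc i))"
    using Suc.prems unfolding path_Suc_iff by auto
  let ?B = "ball (Y (Suc N)) r"
  obtain G where G: "G holomorphic_on ?B" "G (Y (Suc N)) = Y 1"
    "\<And>w. w \<in> ?B \<Longrightarrow> \<exists>X. path c N X \<and> X 0 = G w \<and> X N = w \<and> 
       cmod (deriv G w) * (\<Prod>i<N. speed (cmod (X i))) = 1"
    using Suc.IH[OF Yt] Suc.prems by auto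
  have GU: "G ` ?B \<subseteq> U"
  proof
    fix v assume "v \<in> G ` ?B"
    then obtain w where w: "w \<in> ?B" "v = G w" by blast
    then obtain X where "path c N X" "X 0 = v" "X N = w" using G(3) by metis
    moreover have "w \<in> U" using w(1) Suc.prems(2) by blast
    ultimately show "v \<in> U" using path_in_repeller[OF c, of N X 0] by auto
  qed
  obtain g where g: "g holomorphic_on ?B" "g (Y (Suc N)) = Y 0"
    "\<And>w. w \<in> ?B \<Longrightarrow> (G w - c) ^ q = g w ^ p"
    "\<And>w. w \<in> ?B \<Longrightarrow> cmod (deriv G w) = speed (cmod (g w)) * cmod (deriv g w)"
    by (rule preimage_lift[OF c, of r G "Y (Suc N)" "Y 0"]) (use r(1) G GU Y1 in auto)
  have "\<exists>X. path c (Suc N) X \<and> X 0 = g w \<and> X (Suc N) = w \<and>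
       cmod (deriv g w) * (\<Prod>i<Suc N. speed (cmod (X i))) = 1" if w: "w \<in> ?B" for w
  proof -
    obtain X where X: "path c N X" "X 0 = G w" "X N = w" 
       "cmod (deriv G w) * (\<Prod>i<N. speed (cmod (X i))) = 1" using G(3)[OF w] by blast
    have "cmod (deriv g w) * (\<Prod>i<Suc N. speed (cmod (case_nat (g w) X i)))
       = (speed (cmod (g w)) * cmod (deriv g w)) * (\<Prod>i<N. speed (cmod (X i)))"
      unfolding prod.lessThan_Suc_shift by simp
    also have "\<dots> = 1" using g(4)[OF w] X(4) by simp
    finally show ?thesis
      using path_Cons[OF X(1)] g(3)[OF w] X by (intro exI[of _ "case_nat (g w) X"]) auto
  qed
  then show ?case using g by (intro exI[of _ g]) blast
qed

lemma inverse_contraction: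
  assumes c: "c \<in> W" and Y: "path c N Y" and U: "ball (Y N) \<delta> \<subseteq> U" and N: "4 * R / \<delta> \<le> gain ^ N"
    and r: "r < \<delta> / 2"
  obtains G where "G (Y N) = Y 0"
    "\<And>w. w \<in> cball (Y N) r \<Longrightarrow> \<exists>X. path c N X \<and> X 0 = G w \<and> X N = w"
    "\<And>w w'. w \<in> cball (Y N) r \<Longrightarrow> w' \<in> cball (Y N) r \<Longrightarrow> cmod (G w - G w') \<le> 1 / 2 * cmod (w - w')"
proof -
  have \<delta>: "\<delta> > 0" by (rule repeller_facts)
  have "Y N \<in> U" using U \<delta> by auto
  then have "cmod (Y N) < R" using repeller_facts(2) by auto
  then have R: "R > 0" by (rule order.strict_trans1[OF norm_ge_zero])
  obtain G where G: "G holomorphic_on ball (Y N) \<delta>" "G (Y N) = Y 0"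
    "\<And>w. w \<in> ball (Y N) \<delta> \<Longrightarrow> \<exists>X. path c N X \<and> X 0 = G w \<and> X N = w \<and>
       cmod (deriv G w) * (\<Prod>i<N. speed (cmod (X i))) = 1"
    using inverse_branch_along_path[OF c Y \<delta> U] by blast
  have small: "w \<in> ball (Y N) (\<delta> / 2)" "w \<in> ball (Y N) \<delta>" if "w \<in> cball (Y N) r" for w
    using that r \<delta> by auto
  have dG: "cmod (deriv G w) \<le> 1 / 2" if w: "w \<in> cball (Y N) r" for w
  proof -
    obtain X where X: "path c N X" "X N = w" "cmod (deriv G w) * (\<Prod>i<N. speed (cmod (X i))) = 1"
      using G(3)[OF small(2)[OF w]] by blast
    define Q where "Q = (\<Prod>i<N. speed (cmod (X i)))"
    have "ball w (\<delta> / 2) \<subseteq> ball (Y N) \<delta>"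
      using small(1)[OF w] \<delta> by (simp add: ball_subset_ball_iff dist_commute)
    then have "ball (X N) (\<delta> / 2) \<subseteq> U" using U X by auto
    from expansion[OF c X(1) _ this] \<delta> have e: "\<delta> / 2 * gain ^ N \<le> R * Q"
      by (simp add: Q_def)
    have "\<delta> / 2 * (4 * R / \<delta>) \<le> \<delta> / 2 * gain ^ N"
      using N \<delta> by (intro mult_left_mono) auto
    with e have "R * 2 \<le> R * Q" using \<delta> by simp
    then have "Q \<ge> 2" using R by simp
    then have "cmod (deriv G w) * 2 \<le> cmod (deriv G w) * Q" by (intro mult_left_mono) auto
    then show ?thesis using X(3) by (simp add: Q_def)
  qed
  show thesis
  proof (rule that[of G, OF G(2)])
    show "\<exists>X. path c N X \<and> X 0 = G w \<and> X N = w" if "w \<in> cball (Y N) r" for w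
      using G(3) small(2)[OF that] by blast
    show "cmod (G w - G w') \<le> 1 / 2 * cmod (w - w')"
      if "w \<in> cball (Y N) r" "w' \<in> cball (Y N) r" for w w'
    proof (rule field_differentiable_bound[of "cball (Y N) r" G "deriv G"])
      show "(G has_field_derivative deriv G z) (at z within cball (Y N) r)" if "z \<in> cball (Y N) r" for z
        using holomorphic_derivI[OF G(1) open_ball small(2)[OF that]] .
    qed (use that dG in auto)
  qed
qed

text \<open>The cycle is cut into blocks of a fixed length \<open>N\<close>, long enough for contraction. The closeness
\<open>\<kappa>\<close> of the parameters only has to control one block, which makes it independent of the
period. A cycle of period \<open>n\<close> is traversed \<open>N\<close> times, so that \<open>n\<close>
blocks close up.\<close>

lemma repeller_shadowing:
  assumes "\<epsilon> > 0"
  obtains \<kappa> where "\<kappa> > 0"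
    "\<And>c c' n z. c \<in> W \<Longrightarrow> c' \<in> W \<Longrightarrow> cmod (c' - c) < \<kappa> \<Longrightarrow> corr_cycle p q c n z \<Longrightarrow> range z \<subseteq> U \<Longrightarrow>
       \<exists>m y. corr_cycle p q c' m y \<and> range y \<subseteq> U \<and> cmod (y 0 - z 0) \<le> \<epsilon>"
proof (cases "U = {}")
  case True
  then show thesis by (intro that[of 1]) auto
next
  case False
  have \<delta>: "\<delta> > 0" by (rule repeller_facts)
  define r where "r = min \<epsilon> (\<delta> / 4)"
  have r: "r > 0" "r \<le> \<epsilon>" "r < \<delta> / 2" using \<delta> assms by (auto simp: r_def)
  have gn: "gain > 1" using gain_gt_1[OF False] .
  obtain N0 where "4 * R / \<delta> < gain ^ N0" using real_arch_pow[OF gn] by blast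
  moreover have "gain ^ N0 \<le> gain ^ Suc N0" using gn by (intro power_increasing) auto
  ultimately obtain N where N: "4 * R / \<delta> \<le> gain ^ N" "N > 0" by (meson less_le_trans less_imp_le zero_less_Suc)
  have "r / 2 > 0" using r by simp
  from backward_tracking[OF this, of R N]
  obtain \<kappa> where \<kappa>: "\<kappa> > 0" "\<And>c c' Y. cmod c \<le> R \<Longrightarrow> cmod c' \<le> R \<Longrightarrow> cmod (c' - c) < \<kappa> \<Longrightarrow> path c N Y
      \<Longrightarrow> (\<And>i. i \<le> N \<Longrightarrow> cmod (Y i) \<le> R) \<Longrightarrow> (\<exists>Y'. path c' N Y' \<and> Y' N = Y N \<and> cmod (Y' 0 - Y 0) < r / 2)"
    by blast
  show thesis
  proof (rule that[OF \<kappa>(1)])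
    fix c c' n z assume c: "c \<in> W" "c' \<in> W" "cmod (c' - c) < \<kappa>" and z: "corr_cycle p q c n z" "range z \<subseteq> U"
    have n: "n > 0" and zo: "forward_orbit p q c z" using z(1) by (auto simp: corr_cycle_def)
    have zU: "z i \<in> U" for i using z(2) by blast
    have zR: "cmod (z i) \<le> R" for i using zU[of i] repeller_facts(2) by auto
    have zball: "ball (z i) \<delta> \<subseteq> U" for i
      using repeller_facts(5)[OF c(1) zU[of "Suc i"]] zo by (simp add: forward_orbit_iff)
    have "\<exists>\<Gamma>. (\<forall>w\<in>cball (z (k * N)) r. \<Gamma> w \<in> cball (z 0) r \<and>
             (\<exists>X. path c' (k * N) X \<and> X 0 = \<Gamma> w \<and> X (k * N) = w)) \<and>
           (\<forall>w\<in>cball (z (k * N)) r. \<forall>w'\<in>cball (z (k * N)) r. cmod (\<Gamma> w - \<Gamma> w') \<le> (1 / 2) ^ k * cmod (w - w'))" for k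
    proof (induction k)
      case 0
      show ?case by (intro exI[of _ "\<lambda>w. w"]) (auto simp: path_def)
    next
      case (Suc k)
      then obtain \<Gamma> where \<Gamma>: "\<And>w. w \<in> cball (z (k * N)) r \<Longrightarrow> \<Gamma> w \<in> cball (z 0) r"
        "\<And>w. w \<in> cball (z (k * N)) r \<Longrightarrow> \<exists>X. path c' (k * N) X \<and> X 0 = \<Gamma> w \<and> X (k * N) = w"
        "\<And>w w'. w \<in> cball (z (k * N)) r \<Longrightarrow> w' \<in> cball (z (k * N)) r \<Longrightarrow> cmod (\<Gamma> w - \<Gamma> w') \<le> (1 / 2) ^ k * cmod (w - w')"
        by blast
      have "path c N (\<lambda>i. z (k * N + i))" using forward_orbit_path[OF zo] .
      from \<kappa>(2)[OF _ _ c(3) this]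
      obtain Y where Y: "path c' N Y" "Y N = z (Suc k * N)" "cmod (Y 0 - z (k * N)) < r / 2"
        using zR c repeller_facts(8) by (auto simp: add.commute)
      obtain G where G: "G (Y N) = Y 0"
        "\<And>w. w \<in> cball (Y N) r \<Longrightarrow> \<exists>X. path c' N X \<and> X 0 = G w \<and> X N = w"
        "\<And>w w'. w \<in> cball (Y N) r \<Longrightarrow> w' \<in> cball (Y N) r \<Longrightarrow> cmod (G w - G w') \<le> 1 / 2 * cmod (w - w')"
        by (rule inverse_contraction[OF c(2) Y(1) _ N(1) r(3)]) (use zball[of "Suc k * N"] Y(2) in auto)
      have Gb: "G w \<in> cball (z (k * N)) r" if w: "w \<in> cball (Y N) r" for w
      proof -
        have "cmod (G w - Y 0) \<le> 1 / 2 * cmod (w - Y N)"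
          using G(3)[OF w, of "Y N"] G(1) r by simp
        also have "\<dots> \<le> r / 2" using w by (simp add: dist_norm norm_minus_commute)
        finally have "cmod (G w - z (k * N)) \<le> r"
          using Y(3) norm_triangle_ineq[of "G w - Y 0" "Y 0 - z (k * N)"] by simp
        then show ?thesis by (simp add: dist_norm norm_minus_commute)
      qed
      show ?case
      proof (intro exI[of _ "\<Gamma> \<circ> G"] conjI ballI)
        fix w assume w: "w \<in> cball (z (Suc k * N)) r"
        then have w': "w \<in> cball (Y N) r" by (simp add: Y(2))
        show "(\<Gamma> \<circ> G) w \<in> cball (z 0) r" using \<Gamma>(1)[OF Gb[OF w']] by simp
        obtain X where X: "path c' N X" "X 0 = G w" "X N = w" using G(2)[OF w'] by blast
        obtain X' where X': "path c' (k * N) X'" "X' 0 = \<Gamma> (G w)" "X' (k * N) = G w"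
          using \<Gamma>(2)[OF Gb[OF w']] by blast
        show "\<exists>X. path c' (Suc k * N) X \<and> X 0 = (\<Gamma> \<circ> G) w \<and> X (Suc k * N) = w"
          using path_append[OF X'(1) X(1)] X X' N(2)
          by (intro exI[of _ "\<lambda>i. if i \<le> k * N then X' i else X (i - k * N)"]) (simp add: add.commute)
        fix v assume "v \<in> cball (z (Suc k * N)) r"
        then have v': "v \<in> cball (Y N) r" by (simp add: Y(2))
        have "cmod (\<Gamma> (G w) - \<Gamma> (G v)) \<le> (1 / 2) ^ k * cmod (G w - G v)"
          using \<Gamma>(3) Gb w' v' by blast
        also have "\<dots> \<le> (1 / 2) ^ k * (1 / 2 * cmod (w - v))"
          using G(3)[OF w' v'] by (intro mult_left_mono) auto
        finally show "cmod ((\<Gamma> \<circ> G) w - (\<Gamma> \<circ> G) v) \<le> (1 / 2) ^ Suc k * cmod (w - v)" by simp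
      qed
    qed
    from this[of n] have "\<exists>\<Gamma>. (\<forall>w\<in>cball (z 0) r. \<Gamma> w \<in> cball (z 0) r \<and>
             (\<exists>X. path c' (n * N) X \<and> X 0 = \<Gamma> w \<and> X (n * N) = w)) \<and>
           (\<forall>w\<in>cball (z 0) r. \<forall>w'\<in>cball (z 0) r. cmod (\<Gamma> w - \<Gamma> w') \<le> (1 / 2) ^ n * cmod (w - w'))"
      using cycle_add_mult[OF z(1), of 0 N] by (simp add: mult.commute[of n N])
    then obtain \<Gamma> where \<Gamma>: "\<Gamma> ` cball (z 0) r \<subseteq> cball (z 0) r"
        "\<And>w. w \<in> cball (z 0) r \<Longrightarrow> \<exists>X. path c' (n * N) X \<and> X 0 = \<Gamma> w \<and> X (n * N) = w"
        "\<And>w w'. w \<in> cball (z 0) r \<Longrightarrow> w' \<in> cball (z 0) r \<Longrightarrow> cmod (\<Gamma> w - \<Gamma> w') \<le> (1 / 2) ^ n * cmod (w - w')"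
      by blast
    \<comment> \<open>a fixed point of the composed inverse branches is a periodic point\<close>
    have "\<exists>!w. w \<in> cball (z 0) r \<and> \<Gamma> w = w"
    proof (rule Banach_fix[where c = "(1 / 2) ^ n"])
      show "complete (cball (z 0) r)" by (simp add: complete_eq_closed)
    qed (use r \<Gamma> n in \<open>auto simp: dist_norm power_less_one_iff\<close>)
    then obtain w where w: "w \<in> cball (z 0) r" "\<Gamma> w = w" by blast
    obtain X where X: "path c' (n * N) X" "X 0 = w" "X (n * N) = w" using \<Gamma>(2)[OF w(1)] w(2) by auto
    have cyc: "corr_cycle p q c' (n * N) (\<lambda>i. X (i mod (n * N)))"
      by (rule cycle_of_path) (use X n N in auto)
    have "w \<in> ball (z 0) \<delta>" using w(1) r(3) \<delta> by auto
    then have "w \<in> U" using zball by blast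
    then have "range (\<lambda>i. X (i mod (n * N))) \<subseteq> U"
      using cycle_in_repeller[OF c(2) cyc, of 0] X(2) by simp
    moreover have "cmod (X 0 - z 0) \<le> \<epsilon>"
      using w(1) r(2) X(2) by (simp add: dist_norm norm_minus_commute)
    ultimately show "\<exists>m y. corr_cycle p q c' m y \<and> range y \<subseteq> U \<and> cmod (y 0 - z 0) \<le> \<epsilon>"
      using cyc by (intro exI[of _ "n * N"] exI[of _ "\<lambda>i. X (i mod (n * N))"]) simp
  qed
qed

end

section \<open>Multipliers\<close>

lemma speed_0 [simp]: "speed 0 = 0"
  by (simp add: speed_def)

lemma multiplier_norm:
  assumes z: "corr_cycle p q c n z" and 0: "0 \<notin> range z" and \<mu>: "has_multiplier p q c n z \<mu>"
  shows "cmod \<mu> = (\<Prod>i<n. speed (cmod (z i)))"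
proof -
  obtain V \<phi> where V: "\<And>i. i < n \<Longrightarrow> corr_branch p q c (V i) (\<phi> i) \<and> z i \<in> V i"
    and \<mu>: "\<mu> = (\<Prod>i<n. deriv (\<phi> i) (z i))"
    using \<mu> unfolding has_multiplier_def by blast
  have "cmod (deriv (\<phi> i) (z i)) = speed (cmod (z i))" if "i < n" for i
  proof -
    have "z i \<noteq> 0" using 0 by (metis rangeI)
    then show ?thesis
      using deriv_of_branch[of "V i" "z i" "\<lambda>x. x" "\<phi> i" c] V[OF that] by (auto simp: corr_branch_def)
  qed
  then show ?thesis unfolding \<mu> by (simp flip: prod_norm)
qed

lemma multiplier_exists:
  assumes z: "corr_cycle p q c n z" and 0: "0 \<notin> range z"
  shows "\<exists>\<mu>. has_multiplier p q c n z \<mu>"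
proof -
  have "\<exists>\<phi>. corr_branch p q c (ball (z i) (cmod (z i))) \<phi> \<and> \<phi> (z i) = z (Suc i)" for i
  proof -
    have zi: "z i \<noteq> 0" using 0 by (metis rangeI)
    obtain g where g: "g holomorphic_on ball (z i) (cmod (z i))" "g (z i) = z (Suc i) - c"
      "\<And>w. w \<in> ball (z i) (cmod (z i)) \<Longrightarrow> g w ^ q = w ^ p"
    proof (rule power_root_on_ball[of "\<lambda>w. w" "z i" "cmod (z i)" q "z (Suc i) - c" p])
      show "(z (Suc i) - c) ^ q = z i ^ p" using z by (simp add: corr_cycle_def forward_orbit_iff)
    qed (use zi q_pos in \<open>auto simp: dist_norm\<close>)
    show ?thesis
      using g by (intro exI[of _ "\<lambda>w. g w + c"]) (auto simp: corr_branch_def intro!: holomorphic_intros)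
  qed
  then obtain \<phi> where \<phi>: "\<And>i. corr_branch p q c (ball (z i) (cmod (z i))) (\<phi> i) \<and> \<phi> i (z i) = z (Suc i)"
    by metis
  have "z i \<noteq> 0" for i using 0 by (metis rangeI)
  then show ?thesis unfolding has_multiplier_def
    using \<phi> by (intro exI[of _ "\<Prod>i<n. deriv (\<phi> i) (z i)"] exI[of _ "\<lambda>i. ball (z i) (cmod (z i))"] exI[of _ \<phi>]) auto
qed

lemma zero_speed_product:
  assumes "corr_cycle p q c n z" "0 \<in> range z"
  shows "(\<Prod>i<n. speed (cmod (z i))) = 0"
proof -
  obtain i where "i < n" "z i = 0" using assms by (auto simp: cycle_range)
  then show ?thesis by (intro prod_zero bexI[of _ i]) auto
qed

text \<open>A cycle through \<open>0\<close> has speed product \<open>0\<close>, so the case distinction in the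
definitions of attracting and repelling cycles disappears.\<close>

lemma repelling_iff:
  "repelling_cycle p q c n z \<longleftrightarrow> corr_cycle p q c n z \<and> (\<Prod>i<n. speed (cmod (z i))) > 1"
  using multiplier_norm[of c n z] multiplier_exists[of c n z] zero_speed_product[of c n z]
  unfolding repelling_cycle_def by (metis less_numeral_extra(1) not_less_iff_gr_or_eq)

lemma attracting_iff:
  "attracting_cycle p q c n z \<longleftrightarrow> corr_cycle p q c n z \<and> (\<Prod>i<n. speed (cmod (z i))) < 1"
  using multiplier_norm[of c n z] multiplier_exists[of c n z] zero_speed_product[of c n z]
  unfolding attracting_cycle_def by (metis less_numeral_extra(1))

text \<open>Shifting a cycle changes neither its period nor its range, so it suffices to look at initial points.\<close>

lemma cycle_points_eq:
  assumes "\<And>n z. corr_cycle p q c n z \<Longrightarrow> P n z \<longleftrightarrow> Q (range z)"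
  shows "\<Union>{range z |n z. corr_cycle p q c n z \<and> P n z} = {z 0 |n z. corr_cycle p q c n z \<and> Q (range z)}"
    (is "?L = ?R")
proof
  show "?R \<subseteq> ?L" using assms by blast
  show "?L \<subseteq> ?R"
  proof
    fix x assume "x \<in> ?L"
    then obtain n z k where z: "corr_cycle p q c n z" "P n z" "x = z k" by blast
    have cs: "corr_cycle p q c n (\<lambda>i. z (k + i))" using cycle_shift[OF z(1)] .
    have "range (\<lambda>i. z (k + i)) = range z"
    proof
      show "range z \<subseteq> range (\<lambda>i. z (k + i))"
      proof
        fix y assume "y \<in> range z"
        then obtain i where y: "y = z i" by blast
        have "n > 0" using z(1) by (simp add: corr_cycle_def)
        then have "k \<le> i + k * n" by (simp add: trans_le_add2)
        then have "z (k + (i + k * n - k)) = y" using cycle_add_mult[OF z(1), of i k] y by simp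
        then show "y \<in> range (\<lambda>i. z (k + i))" by (metis rangeI)
      qed
    qed auto
    then have "Q (range (\<lambda>i. z (k + i)))" using assms[OF z(1)] z(2) by simp
    then show "x \<in> ?R" using cs z(3) by (intro CollectI exI[of _ n] exI[of _ "\<lambda>i. z (k + i)"]) simp
  qed
qed

end

section \<open>Continuity from uniform approximation\<close>

text \<open>Because the approximation is uniform for \<open>c, c' \<in> W\<close>, using it in both directions bounds both
halves of the Hausdorff distance.\<close>

lemma hausdorff_continuity:
  fixes F :: "'a::metric_space \<Rightarrow> 'b::metric_space set"
  assumes W: "open W" "c0 \<in> W" and F: "\<And>c. c \<in> W \<Longrightarrow> F c = closure (A c)"
    and approx: "\<And>\<epsilon>. \<epsilon> > 0 \<Longrightarrow> \<exists>\<kappa>>0. \<forall>c\<in>W. \<forall>c'\<in>W. dist c' c < \<kappa> \<longrightarrow> (\<forall>x\<in>A c. \<exists>y\<in>A c'. dist x y \<le> \<epsilon>)"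
  shows "((\<lambda>c. hausdorff_edist (F c) (F c0)) \<longlongrightarrow> 0) (at c0)"
proof (rule order_tendstoI)
  fix e :: ennreal assume "0 < e"
  then obtain y where y: "0 < y" "y < e" using dense by blast
  define \<epsilon> where "\<epsilon> = enn2real y"
  have "y \<noteq> top" using y by auto
  then have \<epsilon>: "\<epsilon> > 0" "ennreal \<epsilon> < e"
    using y by (auto simp: \<epsilon>_def enn2real_positive_iff less_top)
  obtain \<kappa> where \<kappa>: "\<kappa> > 0"
    "\<And>c c' x. c \<in> W \<Longrightarrow> c' \<in> W \<Longrightarrow> dist c' c < \<kappa> \<Longrightarrow> x \<in> A c \<Longrightarrow> \<exists>y\<in>A c'. dist x y \<le> \<epsilon> / 2"
    using approx[of "\<epsilon> / 2"] \<epsilon> by auto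
  have half: "(SUP a\<in>F c. INF b\<in>F c'. ennreal (dist a b)) \<le> ennreal \<epsilon>"
    if c: "c \<in> W" "c' \<in> W" "dist c' c < \<kappa>" for c c'
  proof (rule SUP_least)
    fix a assume "a \<in> F c"
    then obtain x where x: "x \<in> A c" "dist x a < \<epsilon> / 2"
      using F[OF c(1)] \<epsilon> closure_approachable half_gt_zero by metis
    obtain b where b: "b \<in> A c'" "dist x b \<le> \<epsilon> / 2" using \<kappa>(2)[OF c x(1)] by blast
    have "b \<in> F c'" using F[OF c(2)] b(1) closure_subset by blast
    moreover have "dist a b \<le> \<epsilon>" using dist_triangle[of a b x] x b by (simp add: dist_commute)
    ultimately show "(INF b\<in>F c'. ennreal (dist a b)) \<le> ennreal \<epsilon>"
      by (intro INF_lower2[of b] ennreal_leI)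
  qed
  have swap: "(SUP b\<in>F c0. INF a\<in>F c. ennreal (dist a b)) = (SUP b\<in>F c0. INF a\<in>F c. ennreal (dist b a))" for c
    by (simp add: dist_commute)
  have "\<forall>\<^sub>F c in at c0. c \<in> W" using W eventually_at_in_open'[of W c0] by simp
  moreover have "\<forall>\<^sub>F c in at c0. dist c c0 < \<kappa>" using \<kappa>(1) by (auto simp: eventually_at)
  ultimately show "\<forall>\<^sub>F c in at c0. hausdorff_edist (F c) (F c0) < e"
  proof eventually_elim
    case (elim c)
    have "hausdorff_edist (F c) (F c0) \<le> ennreal \<epsilon>"
      unfolding hausdorff_edist_def swap
      using half[of c c0] half[of c0 c] elim W(2) by (simp add: dist_commute)
    then show ?case using \<epsilon>(2) by (rule order.strict_trans1)
  qed
qed auto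

context correspondence
begin

lemma julia_continuous:
  assumes rep: "repeller W U R \<delta>" and W: "open W"
    and rest: "\<And>c n z. c \<in> W \<Longrightarrow> corr_cycle p q c n z \<Longrightarrow> \<not> range z \<subseteq> U \<Longrightarrow> (\<Prod>i<n. speed (cmod (z i))) \<le> 1"
    and c0: "c0 \<in> W"
  shows "((\<lambda>c. hausdorff_edist (julia p q c) (julia p q c0)) \<longlongrightarrow> 0) (at c0)"
proof (rule hausdorff_continuity[OF W c0])
  let ?A = "\<lambda>c. {z 0 |n z. corr_cycle p q c n z \<and> range z \<subseteq> U}"
  show "julia p q c = closure (?A c)" if "c \<in> W" for c
    unfolding julia_def repelling_iff
    by (subst cycle_points_eq[where Q = "\<lambda>S. S \<subseteq> U"])
      (use rest[OF that] cycle_speed_gt_1[OF rep that] in force)+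
  show "\<exists>\<kappa>>0. \<forall>c\<in>W. \<forall>c'\<in>W. dist c' c < \<kappa> \<longrightarrow> (\<forall>x\<in>?A c. \<exists>y\<in>?A c'. dist x y \<le> \<epsilon>)" if pos: "\<epsilon> > 0" for \<epsilon>
  proof -
    obtain \<kappa> where \<kappa>: "\<kappa> > 0"
      "\<And>c c' n z. c \<in> W \<Longrightarrow> c' \<in> W \<Longrightarrow> cmod (c' - c) < \<kappa> \<Longrightarrow> corr_cycle p q c n z \<Longrightarrow> range z \<subseteq> U \<Longrightarrow>
         \<exists>m y. corr_cycle p q c' m y \<and> range y \<subseteq> U \<and> cmod (y 0 - z 0) \<le> \<epsilon>"
      using repeller_shadowing[OF rep pos] by metis
    show ?thesis
    proof (intro exI[of _ \<kappa>] conjI ballI impI)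
      fix c c' x assume c: "c \<in> W" "c' \<in> W" "dist c' c < \<kappa>" and "x \<in> ?A c"
      then obtain n z where z: "x = z 0" "corr_cycle p q c n z" "range z \<subseteq> U" by blast
      then obtain m y where "corr_cycle p q c' m y" "range y \<subseteq> U" "cmod (y 0 - z 0) \<le> \<epsilon>"
        using \<kappa>(2)[OF c(1,2) _ z(2,3)] c(3) by (auto simp: dist_norm)
      then show "\<exists>y\<in>?A c'. dist x y \<le> \<epsilon>"
        using z(1) by (intro bexI[of _ "y 0"]) (auto simp: dist_norm norm_minus_commute)
    qed (rule \<kappa>)
  qed
qed


section \<open>Points with bounded orbits\<close>

definition pre :: "complex \<Rightarrow> complex set \<Rightarrow> complex set" where
  "pre c S = {z. \<exists>w\<in>S. (w - c) ^ q = z ^ p}"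

lemma pre_mono: "S \<subseteq> T \<Longrightarrow> pre c S \<subseteq> pre c T"
  by (auto simp: pre_def)

lemma open_pre:
  assumes "open S" shows "open (pre c S)"
  unfolding open_contains_ball
proof
  fix z assume "z \<in> pre c S"
  then obtain w where w: "w \<in> S" "(w - c) ^ q = z ^ p" by (auto simp: pre_def)
  obtain e where e: "e > 0" "ball w e \<subseteq> S" using assms w(1) by (meson openE)
  define k where "k = speed (cmod z + 1) + 1"
  have k: "k > 0" using speed_nonneg[of "cmod z + 1"] by (simp add: k_def)
  have "ball z (min 1 (e / k)) \<subseteq> pre c S"
  proof
    fix z' assume "z' \<in> ball z (min 1 (e / k))"
    then have z': "cmod (z' - z) < 1" "cmod (z' - z) < e / k" by (auto simp: dist_norm norm_minus_commute)
    then have "cmod z' \<le> cmod z + 1" using norm_triangle_sub[of z' z] by simp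
    then obtain v where v: "v ^ q = z' ^ p" "cmod (v - (w - c)) \<le> speed (cmod z + 1) * cmod (z' - z)"
      using forward_lipschitz[OF w(2), of "cmod z + 1" z'] by auto
    have "cmod (v + c - w) \<le> speed (cmod z + 1) * cmod (z' - z)"
      using v(2) by (simp add: algebra_simps)
    also have "\<dots> \<le> k * cmod (z' - z)" by (intro mult_right_mono) (auto simp: k_def)
    also have "\<dots> < e" using z'(2) k by (simp add: field_simps)
    finally have "v + c \<in> S" using e(2) by (auto simp: dist_norm norm_minus_commute)
    then show "z' \<in> pre c S" unfolding pre_def using v(1) by (auto intro!: bexI[of _ "v + c"])
  qed
  then show "\<exists>e>0. ball z e \<subseteq> pre c S" using e k by (intro exI[of _ "min 1 (e / k)"]) auto
qed

lemma compact_pre: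
  assumes S: "compact S" shows "compact (pre c S)"
proof -
  obtain B where B: "\<And>w. w \<in> S \<Longrightarrow> cmod w \<le> B" "B \<ge> 0"
    using compact_imp_bounded[OF S] by (metis bounded_pos less_imp_le)
  define b where "b = 1 + (B + cmod c) ^ q"
  have b: "cmod z \<le> b" if "w \<in> S" "(w - c) ^ q = z ^ p" for z w
  proof (cases "cmod z \<le> 1")
    case False
    then have "cmod z \<le> cmod z ^ p" using p_pos by (simp add: self_le_power)
    also have "\<dots> = cmod (w - c) ^ q" using that(2) by (metis norm_power)
    also have "\<dots> \<le> (B + cmod c) ^ q"
      using B(1)[OF that(1)] norm_triangle_ineq4[of w c] by (intro power_mono) auto
    finally show ?thesis by (simp add: b_def)
  qed (use B in \<open>auto simp: b_def intro: add_increasing2\<close>)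
  have "pre c S = fst ` ((cball 0 b \<times> S) \<inter> {x. (snd x - c) ^ q = fst x ^ p})"
    using b by (force simp: pre_def image_iff)
  moreover have "closed {x :: complex \<times> complex. (snd x - c) ^ q = fst x ^ p}"
    by (intro closed_Collect_eq continuous_intros)
  then have "compact ((cball 0 b \<times> S) \<inter> {x. (snd x - c) ^ q = fst x ^ p})"
    using S by (intro compact_Int_closed compact_Times) auto
  then have "compact (fst ` ((cball 0 b \<times> S) \<inter> {x. (snd x - c) ^ q = fst x ^ p}))"
    by (intro compact_continuous_image continuous_intros)
  ultimately show ?thesis by simp
qed

text \<open>The points with an orbit of \<open>m\<close> steps that ends in the open disc of radius \<open>R\<close>;
\<open>clevel\<close> is the analogue for the closed disc.\<close>

definition level :: "complex \<Rightarrow> real \<Rightarrow> nat \<Rightarrow> complex set" where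
  "level c R m = (pre c ^^ m) (ball 0 R)"

definition clevel :: "complex \<Rightarrow> real \<Rightarrow> nat \<Rightarrow> complex set" where
  "clevel c R m = (pre c ^^ m) (cball 0 R)"

lemma pre_trap:
  assumes R: "2 ^ q < R" "cmod c + 1 \<le> R"
  shows "pre c (cball 0 R) \<subseteq> ball 0 R"
proof
  fix z assume "z \<in> pre c (cball 0 R)"
  then obtain w where "cmod w \<le> R" "(w - c) ^ q = z ^ p" by (auto simp: pre_def)
  then show "z \<in> ball 0 R" using escape_step[OF R, of z w] by force
qed

lemma open_level: "open (level c R m)"
  unfolding level_def by (induction m) (auto simp: open_pre)

lemma compact_clevel: "compact (clevel c R m)"
  unfolding clevel_def by (induction m) (auto simp: compact_pre)

lemma level_subset_clevel: "level c R m \<subseteq> clevel c R m"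
  unfolding level_def clevel_def by (induction m) (auto intro: pre_mono[THEN subsetD])

lemma clevel_Suc: "clevel c R (Suc m) = pre c (clevel c R m)"
  by (simp add: clevel_def)

context
  fixes c R
  assumes R: "2 ^ q < R" "cmod c + 1 \<le> R"
begin

text \<open>The preimage of the closed disc lies in the open disc; taking further preimages preserves this inclusion.\<close>

lemma clevel_Suc_subset_level: "clevel c R (Suc m) \<subseteq> level c R m"
proof (induction m)
  case 0
  then show ?case using pre_trap[OF R] by (simp add: clevel_def level_def)
next
  case (Suc m)
  then show ?case using pre_mono[OF Suc] by (simp add: clevel_def level_def)
qed

lemma closure_level: "closure (level c R m) \<subseteq> clevel c R m"
  using compact_imp_closed[OF compact_clevel] level_subset_clevel by (rule closure_minimal[rotated])

lemma pre_closure_level: "pre c (closure (level c R m)) \<subseteq> level c R m"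
  using pre_mono[OF closure_level, of c m] clevel_Suc_subset_level[of m] by (simp add: clevel_Suc)

lemma level_antimono: "m \<le> k \<Longrightarrow> level c R k \<subseteq> level c R m"
proof (induction k rule: dec_induct)
  case (step k)
  have "level c R (Suc k) \<subseteq> level c R k"
    using level_subset_clevel clevel_Suc_subset_level by blast
  then show ?case using step by blast
qed simp

lemma level_subset_ball: "level c R m \<subseteq> ball 0 R"
  using level_antimono[of 0 m] by (simp add: level_def)

lemma bounded_orbit_in_level:
  assumes "forward_orbit p q c z" "bounded (range z)"
  shows "z i \<in> level c R m"
proof (induction m arbitrary: i)
  case 0
  then show ?case using bounded_orbit_in_ball[OF R assms] by (simp add: level_def)
next
  case (Suc m)
  then show ?case using assms(1) by (auto simp: level_def pre_def forward_orbit_iff)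
qed

text \<open>Koenig's lemma: a point has finitely many images, and the levels decrease, so some image of a point lying in
all levels lies again in all levels.\<close>

lemma in_all_levels:
  assumes "\<And>m. x \<in> level c R m"
  shows "x \<in> filled_julia p q c"
proof -
  let ?good = "\<lambda>x. \<forall>m. x \<in> level c R m"
  have step: "\<exists>y. (y - c) ^ q = x ^ p \<and> ?good y" if x: "?good x" for x
  proof (rule ccontr)
    assume "\<not> ?thesis"
    then obtain f where f: "\<And>y. (y - c) ^ q = x ^ p \<Longrightarrow> y \<notin> level c R (f y)" by metis
    let ?Y = "{y. (y - c) ^ q = x ^ p}"
    have "?Y = (\<lambda>v. v + c) ` {v. v ^ q = x ^ p}"
      by (force simp: image_iff intro: exI[of _ "y - c" for y])
    moreover have "finite {v. v ^ q = x ^ p}" using q_pos by (intro finite_nth_roots) auto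
    ultimately have fin: "finite ?Y" by simp
    define M where "M = Max (f ` ?Y)"
    have M: "y \<notin> level c R M" if "(y - c) ^ q = x ^ p" for y
    proof -
      have "f y \<le> M" unfolding M_def using fin that by (intro Max_ge) auto
      then show ?thesis using f[OF that] level_antimono by blast
    qed
    have "x \<in> level c R (Suc M)" using x by blast
    then show False using M by (auto simp: level_def pre_def)
  qed
  have "\<exists>z. \<forall>i. (?good (z i) \<and> (i = 0 \<longrightarrow> z i = x)) \<and> (z (Suc i) - c) ^ q = z i ^ p"
  proof (rule dependent_nat_choice)
    show "\<exists>y. ?good y \<and> ((0::nat) = 0 \<longrightarrow> y = x)" using assms by blast
    show "\<exists>y. (?good y \<and> (Suc i = 0 \<longrightarrow> y = x)) \<and> (y - c) ^ q = u ^ p"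
      if "?good u \<and> (i = 0 \<longrightarrow> u = x)" for u and i :: nat
      using step[of u] that by auto
  qed
  then obtain z where z: "\<And>i. z i \<in> level c R 0" "z 0 = x" "\<And>i. (z (Suc i) - c) ^ q = z i ^ p" by blast
  have "range z \<subseteq> ball 0 R" using z(1) by (auto simp: level_def)
  then have "bounded (range z)" using bounded_subset bounded_ball by blast
  then show ?thesis using z by (auto simp: filled_julia_def forward_orbit_iff)
qed

end

text \<open>A bounded orbit of \<open>c'\<close> is tracked for \<open>m + 1\<close> steps by an orbit of \<open>c\<close>
ending in the closed disc. The additional step puts its start into a compact subset of the open level
\<open>m\<close>.\<close>

lemma bounded_orbits_in_level_nearby:
  assumes R: "2 ^ q < R" "cmod c + 2 \<le> R"
  obtains \<kappa> where "\<kappa> > 0" "\<And>c' z i. cmod (c' - c) < \<kappa> \<Longrightarrow> forward_orbit p q c' z \<Longrightarrow> bounded (range z)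
     \<Longrightarrow> z i \<in> level c R m"
proof -
  have R': "cmod c + 1 \<le> R" using R by simp
  obtain \<epsilon> where \<epsilon>: "\<epsilon> > 0" "(\<Union>x\<in>clevel c R (Suc m). ball x \<epsilon>) \<subseteq> level c R m"
    using compact_subset_open_imp_ball_epsilon_subset[OF compact_clevel open_level clevel_Suc_subset_level[OF R(1) R']]
    by blast
  obtain \<kappa> where \<kappa>: "\<kappa> > 0" "\<And>c c' Y. cmod c \<le> R \<Longrightarrow> cmod c' \<le> R \<Longrightarrow> cmod (c' - c) < \<kappa> \<Longrightarrow> path c (Suc m) Y
      \<Longrightarrow> (\<And>i. i \<le> Suc m \<Longrightarrow> cmod (Y i) \<le> R) \<Longrightarrow> (\<exists>Y'. path c' (Suc m) Y' \<and> Y' (Suc m) = Y (Suc m) \<and> cmod (Y' 0 - Y 0) < \<epsilon>)"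
    using backward_tracking[OF \<epsilon>(1), of R "Suc m"] by blast
  show thesis
  proof (rule that[of "min \<kappa> 1"])
    fix c' z i assume c': "cmod (c' - c) < min \<kappa> 1" and z: "forward_orbit p q c' z" "bounded (range z)"
    have n: "cmod c' + 1 \<le> R" using norm_triangle_sub[of c' c] c' R by simp
    have zR: "cmod (z j) \<le> R" for j using bounded_orbit_in_ball[OF R(1) n z] by (simp add: less_imp_le)
    have "\<exists>Y. path c (Suc m) Y \<and> Y (Suc m) = z (i + Suc m) \<and> cmod (Y 0 - z (i + 0)) < \<epsilon>"
      by (rule \<kappa>(2)[OF _ _ _ forward_orbit_path[OF z(1)]])
        (use c' n R' zR in \<open>auto simp: norm_minus_commute\<close>)
    then obtain Y where Y: "path c (Suc m) Y" "Y (Suc m) = z (i + Suc m)" "cmod (Y 0 - z i) < \<epsilon>" by auto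
    have "Y (Suc m - k) \<in> clevel c R k" if "k \<le> Suc m" for k
      using that
    proof (induction k)
      case 0
      then show ?case using Y(2) zR by (simp add: clevel_def)
    next
      case (Suc k)
      have "(Y (Suc (m - k)) - c) ^ q = Y (m - k) ^ p" using Y(1) Suc.prems unfolding path_def by force
      then show ?case using Suc by (auto simp: clevel_Suc pre_def Suc_diff_le)
    qed
    from this[of "Suc m"] have "Y 0 \<in> clevel c R (Suc m)" by simp
    moreover have "z i \<in> ball (Y 0) \<epsilon>" using Y(3) by (simp add: dist_norm)
    ultimately show "z i \<in> level c R m" using \<epsilon>(2) by blast
  qed (use \<kappa> in auto)
qed

text \<open>The hypothesis is an inclusion of a compact set in an open one, and such an inclusion persists under small
changes of the parameter.\<close>

lemma repeller_nearby:
  assumes U: "open U" "U \<subseteq> ball 0 R" "0 \<notin> U" and c: "cmod c + 1 \<le> R" and inv: "pre c (closure U) \<subseteq> U"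
  obtains \<kappa> \<delta> where "\<kappa> > 0" "repeller (ball c \<kappa>) U R \<delta>"
proof -
  have "bounded U" using U(2) bounded_subset bounded_ball by blast
  then have "compact (closure U)" by simp
  then obtain \<epsilon> where \<epsilon>: "\<epsilon> > 0" "(\<Union>x\<in>pre c (closure U). ball x \<epsilon>) \<subseteq> U"
    using compact_subset_open_imp_ball_epsilon_subset[OF compact_pre U(1) inv] by blast
  have "\<epsilon> / 2 > 0" using \<epsilon> by simp
  from preimage_tracking[OF this, of "2 * R"]
  obtain \<kappa> where \<kappa>: "\<kappa> > 0" "\<And>c c' z w w'. (w - c) ^ q = z ^ p \<Longrightarrow> cmod (w - c) \<le> 2 * R \<Longrightarrow> cmod (w' - c') \<le> 2 * R
      \<Longrightarrow> cmod ((w' - c') - (w - c)) < \<kappa> \<Longrightarrow> \<exists>z'. (w' - c') ^ q = z' ^ p \<and> cmod (z' - z) < \<epsilon> / 2"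
    by blast
  have cR: "cmod c' \<le> R" if "c' \<in> ball c (min \<kappa> 1)" for c'
    using norm_triangle_sub[of c' c] that c by (simp add: dist_norm norm_minus_commute)
  have "repeller (ball c (min \<kappa> 1)) U R (\<epsilon> / 2)"
    unfolding repeller_def
  proof (intro conjI ballI allI impI)
    show "ball c (min \<kappa> 1) \<subseteq> cball 0 R" using cR by auto
    fix c' z w assume c': "c' \<in> ball c (min \<kappa> 1)" and w: "w \<in> U" "(w - c') ^ q = z ^ p"
    have wR: "cmod w \<le> R" using w(1) U(2) by auto
    obtain z' where z': "(w - c) ^ q = z' ^ p" "cmod (z' - z) < \<epsilon> / 2"
      using \<kappa>(2)[OF w(2), of w c] wR cR[OF c'] c c' norm_triangle_ineq4[of w c'] norm_triangle_ineq4[of w c]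
      by (auto simp: dist_norm norm_minus_commute)
    have "z' \<in> pre c (closure U)" using z'(1) w(1) closure_subset by (auto simp: pre_def)
    moreover have "ball z (\<epsilon> / 2) \<subseteq> ball z' \<epsilon>"
      using z'(2) by (simp add: ball_subset_ball_iff dist_norm norm_minus_commute)
    ultimately show "ball z (\<epsilon> / 2) \<subseteq> U" using \<epsilon>(2) by blast
  qed (use U \<epsilon> in auto)
  with \<kappa>(1) show thesis by (intro that[of "min \<kappa> 1"]) auto
qed

text \<open>Continuity is required on a neighbourhood and not only at \<open>c0\<close>, so that the set of these
parameters is open.\<close>

definition locally_continuous :: "complex \<Rightarrow> bool" where
  "locally_continuous c0 \<longleftrightarrow> (\<exists>W. open W \<and> c0 \<in> W \<and> (\<forall>c1\<in>W.
     ((\<lambda>c. hausdorff_edist (julia p q c) (julia p q c1)) \<longlongrightarrow> 0) (at c1) \<and>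
     ((\<lambda>c. hausdorff_edist (dual_julia p q c) (dual_julia p q c1)) \<longlongrightarrow> 0) (at c1)))"

text \<open>Some level omits \<open>0\<close> and is a repeller containing all cycles of nearby parameters.\<close>

lemma outside_mandel:
  assumes "c0 \<notin> mandel p q"
  shows "locally_continuous c0"
proof -
  define R where "R = 2 ^ q + cmod c0 + 2"
  have R: "2 ^ q < R" "cmod c0 + 1 \<le> R" "cmod c0 + 2 \<le> R" 
    using norm_ge_zero[of c0] zero_le_power[of "2::real" q] unfolding R_def by linarith+
  obtain m where m: "0 \<notin> level c0 R m"
    using in_all_levels[OF R(1,2), of 0] assms by (auto simp: mandel_def)
  let ?U = "level c0 R m"
  obtain \<kappa>1 \<delta> where \<kappa>1: "\<kappa>1 > 0" "repeller (ball c0 \<kappa>1) ?U R \<delta>"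
    using repeller_nearby[OF open_level level_subset_ball[OF R(1,2)] m R(2) pre_closure_level[OF R(1,2)]] by blast
  obtain \<kappa>2 where \<kappa>2: "\<kappa>2 > 0"
    "\<And>c' z i. cmod (c' - c0) < \<kappa>2 \<Longrightarrow> forward_orbit p q c' z \<Longrightarrow> bounded (range z) \<Longrightarrow> z i \<in> ?U"
    using bounded_orbits_in_level_nearby[OF R(1,3)] by metis
  define W where "W = ball c0 (min \<kappa>1 \<kappa>2)"
  have W: "open W" "c0 \<in> W" "W \<subseteq> ball c0 \<kappa>1" using \<kappa>1(1) \<kappa>2(1) by (auto simp: W_def)
  have rep: "repeller W ?U R \<delta>" using \<kappa>1(2) W(3) unfolding repeller_def by blast
  have all: "range z \<subseteq> ?U" if "c \<in> W" "corr_cycle p q c n z" for c n z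
    using \<kappa>2(2)[of c z] cycle_bounded[OF that(2)] that by (auto simp: W_def corr_cycle_def dist_norm norm_minus_commute)
  have empty: "dual_julia p q c = {}" if "c \<in> W" for c
    unfolding dual_julia_def attracting_iff using cycle_speed_gt_1[OF rep that] all[OF that] by (auto dest: order.asym)
  show ?thesis
    unfolding locally_continuous_def
  proof (intro exI[of _ W] conjI ballI W(1,2))
    fix c1 assume c1: "c1 \<in> W"
    show "((\<lambda>c. hausdorff_edist (julia p q c) (julia p q c1)) \<longlongrightarrow> 0) (at c1)"
      by (rule julia_continuous[OF rep W(1) _ c1]) (use all in blast)
    show "((\<lambda>c. hausdorff_edist (dual_julia p q c) (dual_julia p q c1)) \<longlongrightarrow> 0) (at c1)"
      by (rule hausdorff_continuity[OF W(1) c1, where A = "\<lambda>_. {}"]) (use empty in \<open>auto intro: exI[of _ 1]\<close>)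
  qed
qed

end

section \<open>Contraction near a superattracting cycle\<close>

lemma geometric_limit:
  fixes X :: "nat \<Rightarrow> complex"
  assumes "\<And>j. cmod (X (Suc j) - X j) \<le> (1 / 2) ^ j * d"
  obtains l where "X \<longlonglongrightarrow> l" "cmod (l - X 0) \<le> 2 * d"
proof -
  have g: "(\<lambda>j. (1 / 2) ^ j * d) sums (2 * d)"
    using sums_mult2[OF geometric_sums[of "1 / 2 :: real"], of d] by simp
  have s: "summable (\<lambda>j. norm (X (Suc j) - X j))"
    by (rule summable_comparison_test'[OF sums_summable[OF g], of 0]) (use assms in auto)
  have "(\<lambda>k. \<Sum>j<k. X (Suc j) - X j) \<longlonglongrightarrow> (\<Sum>j. X (Suc j) - X j)"
    using summable_norm_cancel[OF s] by (rule summable_LIMSEQ)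
  then have "(\<lambda>k. X k - X 0 + X 0) \<longlonglongrightarrow> (\<Sum>j. X (Suc j) - X j) + X 0"
    unfolding sum_lessThan_telescope by (intro tendsto_intros)
  moreover have "cmod (\<Sum>j. X (Suc j) - X j) \<le> (\<Sum>j. norm (X (Suc j) - X j))"
    by (rule summable_norm[OF s])
  moreover have "(\<Sum>j. norm (X (Suc j) - X j)) \<le> (\<Sum>j. (1 / 2) ^ j * d)"
    by (rule suminf_le[OF _ s sums_summable[OF g]]) (use assms in auto)
  ultimately show thesis
    using sums_unique[OF g] by (intro that[of "(\<Sum>j. X (Suc j) - X j) + X 0"]) auto
qed

context correspondence
begin

text \<open>A periodic chain of sets \<open>N i\<close> such that every image point of \<open>N i\<close> that lies in
\<open>L\<close> belongs to \<open>N (i + 1)\<close>, and on which the correspondence is a set-valued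
\<open>1/2\<close>-contraction for the distance weighted by \<open>\<omega> i\<close>, up to an error
proportional to the change of parameter. The weights are needed because only the step from a neighbourhood of
\<open>0\<close> contracts, while the other steps may expand.\<close>

definition attractor :: "complex set \<Rightarrow> complex set \<Rightarrow> (nat \<Rightarrow> complex set) \<Rightarrow> (nat \<Rightarrow> real) \<Rightarrow> real \<Rightarrow> nat \<Rightarrow> bool" where
  "attractor W L N \<omega> \<Omega> n \<longleftrightarrow> n > 0 \<and> (\<forall>i. closed (N i) \<and> N (i + n) = N i \<and> \<omega> (i + n) = \<omega> i \<and> 1 \<le> \<omega> i \<and> \<omega> i \<le> \<Omega>) \<and>
     (\<forall>i. \<forall>c\<in>W. \<forall>z\<in>N i. \<forall>w\<in>L. (w - c) ^ q = z ^ p \<longrightarrow> w \<in> N (Suc i)) \<and>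
     (\<forall>i. \<forall>c\<in>W. \<forall>c'\<in>W. \<forall>z\<in>N i. \<forall>y\<in>N i. \<forall>w\<in>N (Suc i). (w - c) ^ q = z ^ p \<longrightarrow>
        (\<exists>w'\<in>N (Suc i). (w' - c') ^ q = y ^ p \<and> \<omega> (Suc i) * cmod (w' - w) \<le> 1 / 2 * (\<omega> i * cmod (y - z)) + \<Omega> * cmod (c' - c))) \<and>
     (\<forall>i. \<forall>z\<in>N i. \<omega> (Suc i) * speed (cmod z) \<le> 1 / 2 * \<omega> i)"

context
  fixes W L N \<omega> \<Omega> n
  assumes att: "attractor W L N \<omega> \<Omega> n"
begin

lemma attractor_facts:
  shows "n > 0" "closed (N i)" "N (i + n) = N i" "\<omega> (i + n) = \<omega> i" "1 \<le> \<omega> i" "\<omega> i \<le> \<Omega>"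
    and "c \<in> W \<Longrightarrow> z \<in> N i \<Longrightarrow> w \<in> L \<Longrightarrow> (w - c) ^ q = z ^ p \<Longrightarrow> w \<in> N (Suc i)"
    and "c \<in> W \<Longrightarrow> c' \<in> W \<Longrightarrow> z \<in> N i \<Longrightarrow> y \<in> N i \<Longrightarrow> w \<in> N (Suc i) \<Longrightarrow> (w - c) ^ q = z ^ p \<Longrightarrow>
        \<exists>w'\<in>N (Suc i). (w' - c') ^ q = y ^ p \<and> \<omega> (Suc i) * cmod (w' - w) \<le> 1 / 2 * (\<omega> i * cmod (y - z)) + \<Omega> * cmod (c' - c)"
    and "z \<in> N i \<Longrightarrow> \<omega> (Suc i) * speed (cmod z) \<le> 1 / 2 * \<omega> i"
  using att unfolding attractor_def by blast+

lemma N_mult: "N (i + k * n) = N i"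
  by (induction k) (use attractor_facts(3)[of "i + k * n" for k] in \<open>simp_all add: algebra_simps\<close>)

lemma \<omega>_mult: "\<omega> (i + k * n) = \<omega> i"
  by (induction k) (use attractor_facts(4)[of "i + k * n" for k] in \<open>simp_all add: algebra_simps\<close>)

lemma orbit_in_attractor:
  assumes c: "c \<in> W" and z: "forward_orbit p q c z" "range z \<subseteq> L" "z 0 \<in> N k"
  shows "z i \<in> N (k + i)"
proof (induction i)
  case (Suc i)
  then show ?case using attractor_facts(7)[OF c Suc, of "z (Suc i)"] z by (auto simp: forward_orbit_iff)
qed (use z in simp)

lemma attractor_speed:
  assumes c: "c \<in> W" and z: "corr_cycle p q c m z" "range z \<subseteq> L" "z 0 \<in> N k"
  shows "(\<Prod>i<m. speed (cmod (z i))) < 1"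
proof (rule ccontr)
  assume "\<not> ?thesis"
  then have ge: "1 \<le> (\<Prod>i<m. speed (cmod (z i)))" by simp
  have zN: "z i \<in> N (k + i)" for i
    using orbit_in_attractor[OF c _ z(2,3)] z(1) by (simp add: corr_cycle_def)
  have le: "\<omega> (k + M) * (\<Prod>i<M. speed (cmod (z i))) \<le> (1 / 2) ^ M * \<omega> k" for M
  proof (induction M)
    case (Suc M)
    have "\<omega> (k + Suc M) * (\<Prod>i<Suc M. speed (cmod (z i)))
       = (\<omega> (Suc (k + M)) * speed (cmod (z M))) * (\<Prod>i<M. speed (cmod (z i)))" by (simp add: mult_ac)
    also have "\<dots> \<le> (1 / 2 * \<omega> (k + M)) * (\<Prod>i<M. speed (cmod (z i)))"
      using attractor_facts(9)[OF zN[of M]] by (intro mult_right_mono prod_nonneg) (auto simp: speed_nonneg)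
    also have "\<dots> \<le> 1 / 2 * ((1 / 2) ^ M * \<omega> k)" using Suc by simp
    finally show ?case by simp
  qed simp
  have m: "m > 0" using z(1) by (simp add: corr_cycle_def)
  have "\<omega> k * 1 \<le> \<omega> k * (\<Prod>i<n * m. speed (cmod (z i)))"
  proof (intro mult_left_mono)
    have "(\<Prod>i<n * m. speed (cmod (z i))) = (\<Prod>i<m. speed (cmod (z i))) ^ n"
      by (rule prod_over_periods) (simp add: cycle_add_mult[OF z(1)])
    then show "1 \<le> (\<Prod>i<n * m. speed (cmod (z i)))" using ge by (simp add: one_le_power)
  qed (use attractor_facts(5)[of k] in simp)
  also have "\<dots> \<le> (1 / 2) ^ (n * m) * \<omega> k"
    using le[of "n * m"] \<omega>_mult[of k m] by (simp add: mult.commute[of n m])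
  also have "\<dots> < 1 * \<omega> k"
    using m attractor_facts(1) attractor_facts(5)[of k]
    by (intro mult_strict_right_mono) (auto simp: power_less_one_iff)
  finally show False by simp
qed

text \<open>Choosing at each step the image provided by the contraction, the initial deviation decays geometrically and
the errors from the change of parameter add up to at most \<open>2 \<Omega> \<bar>c' - c\<bar>\<close>.\<close>

lemma orbit_tracking:
  assumes c: "c \<in> W" "c' \<in> W" and z: "forward_orbit p q c z" "\<And>i. z i \<in> N (k + i)" and x: "x \<in> N k"
  obtains y where "forward_orbit p q c' y" "y 0 = x" "\<And>i. y i \<in> N (k + i)"
    "\<And>i. \<omega> (k + i) * cmod (y i - z i) \<le> (1 / 2) ^ i * (\<omega> k * cmod (x - z 0)) + 2 * \<Omega> * cmod (c' - c)"
proof -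
  let ?b = "\<lambda>i. (1 / 2) ^ i * (\<omega> k * cmod (x - z 0)) + 2 * \<Omega> * cmod (c' - c)"
  let ?P = "\<lambda>i w. w \<in> N (k + i) \<and> (i = 0 \<longrightarrow> w = x) \<and> \<omega> (k + i) * cmod (w - z i) \<le> ?b i"
  have \<Omega>: "\<Omega> \<ge> 0" using attractor_facts(5,6)[of 0] by simp
  have "\<exists>y. \<forall>i. ?P i (y i) \<and> (y (Suc i) - c') ^ q = y i ^ p"
  proof (rule dependent_nat_choice)
    show "\<exists>w. ?P 0 w" using x \<Omega> by auto
    fix u i assume u: "?P i u"
    have zz: "(z (Suc i) - c) ^ q = z i ^ p" using z(1) by (simp add: forward_orbit_iff)
    have z': "z (Suc i) \<in> N (Suc (k + i))" using z(2)[of "Suc i"] by simp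
    obtain w where w: "w \<in> N (Suc (k + i))" "(w - c') ^ q = u ^ p"
      "\<omega> (Suc (k + i)) * cmod (w - z (Suc i)) \<le> 1 / 2 * (\<omega> (k + i) * cmod (u - z i)) + \<Omega> * cmod (c' - c)"
      using attractor_facts(8)[OF c z(2)[of i] _ z' zz, of u] u by blast
    have "1 / 2 * (\<omega> (k + i) * cmod (u - z i)) \<le> 1 / 2 * ?b i" using u by simp
    with w show "\<exists>w. ?P (Suc i) w \<and> (w - c') ^ q = u ^ p"
      by (intro exI[of _ w]) (auto simp: algebra_simps)
  qed
  then obtain y where "\<And>i. ?P i (y i)" "\<And>i. (y (Suc i) - c') ^ q = y i ^ p" by blast
  then show thesis by (intro that[of y]) (auto simp: forward_orbit_iff)
qed

text \<open>Nadler's fixed point argument: an orbit that almost closes up after \<open>m * n\<close> steps is tracked by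
one that starts where it ended, this one by a third, and so on. The successive orbits converge pointwise, and
the limit closes up. The length is a multiple of \<open>n\<close> so that the weights and sets at both ends
agree.\<close>

lemma closing:
  assumes c: "c \<in> W" and y: "forward_orbit p q c y" "\<And>i. y i \<in> N (k + i)"
    and m: "m > 0" and d: "\<omega> k * cmod (y (m * n) - y 0) \<le> d"
  obtains z where "corr_cycle p q c (m * n) z" "\<And>i. z i \<in> N (k + i)" "cmod (z 0 - y 0) \<le> 2 * d"
proof -
  define T where "T = m * n"
  have T: "T > 0" using m attractor_facts(1) by (simp add: T_def)
  have NT: "N (i + T) = N i" and \<omega>T: "\<omega> (i + T) = \<omega> i" for i
    unfolding T_def by (rule N_mult \<omega>_mult)+
  let ?orb = "\<lambda>Y. forward_orbit p q c Y \<and> (\<forall>i. Y i \<in> N (k + i))"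
  let ?P = "\<lambda>j Y. ?orb Y \<and> \<omega> k * cmod (Y T - Y 0) \<le> (1 / 2) ^ j * d \<and> (j = 0 \<longrightarrow> Y = y)"
  let ?Q = "\<lambda>j Y Y'. Y' 0 = Y T \<and> (\<forall>i. cmod (Y' i - Y i) \<le> (1 / 2) ^ j * d)"
  have "\<exists>Y. \<forall>j. ?P j (Y j) \<and> ?Q j (Y j) (Y (Suc j))"
  proof (rule dependent_nat_choice)
    show "\<exists>Y. ?P 0 Y" using y d by (auto simp: T_def)
    fix Y j assume Y: "?P j Y"
    have "Y T \<in> N k" using Y NT[of k] by metis
    then obtain Y' where Y': "forward_orbit p q c Y'" "Y' 0 = Y T" "\<And>i. Y' i \<in> N (k + i)"
      "\<And>i. \<omega> (k + i) * cmod (Y' i - Y i) \<le> (1 / 2) ^ i * (\<omega> k * cmod (Y T - Y 0)) + 2 * \<Omega> * cmod (c - c)"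
      using orbit_tracking[OF c c, of Y k "Y T"] Y by blast
    have b: "\<omega> (k + i) * cmod (Y' i - Y i) \<le> (1 / 2) ^ i * ((1 / 2) ^ j * d)" for i
      using Y'(4)[of i] Y by (auto intro: order_trans mult_left_mono)
    have d0: "(1 / 2) ^ j * d \<ge> 0"
      using Y attractor_facts(5)[of k] by (meson mult_nonneg_nonneg norm_ge_zero order_trans zero_le_one)
    have "cmod (Y' i - Y i) \<le> (1 / 2) ^ j * d" for i
    proof -
      have "1 * cmod (Y' i - Y i) \<le> \<omega> (k + i) * cmod (Y' i - Y i)"
        using attractor_facts(5) by (intro mult_right_mono) auto
      also have "\<dots> \<le> 1 * ((1 / 2) ^ j * d)"
        by (rule order_trans[OF b[of i] mult_right_mono]) (use d0 in \<open>auto simp: power_le_one\<close>)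
      finally show ?thesis by simp
    qed
    moreover have "\<omega> k * cmod (Y' T - Y' 0) \<le> (1 / 2) ^ Suc j * d"
    proof -
      have "\<omega> k * cmod (Y' T - Y' 0) \<le> (1 / 2) ^ T * ((1 / 2) ^ j * d)"
        using b[of T] \<omega>T[of k] Y'(2) by simp
      also have "\<dots> \<le> (1 / 2) ^ 1 * ((1 / 2) ^ j * d)"
        using T d0 by (intro mult_right_mono power_decreasing) auto
      finally show ?thesis by simp
    qed
    ultimately show "\<exists>Y'. ?P (Suc j) Y' \<and> ?Q j Y Y'"
      using Y' by (intro exI[of _ Y']) auto
  qed
  then obtain Y where Y: "\<And>j. ?P j (Y j)" "\<And>j. ?Q j (Y j) (Y (Suc j))" by blast
  have "\<exists>l. (\<lambda>j. Y j i) \<longlonglongrightarrow> l \<and> cmod (l - Y 0 i) \<le> 2 * d" for i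
    using geometric_limit[of "\<lambda>j. Y j i" d] Y(2) by metis
  then obtain Z where Z: "\<And>i. (\<lambda>j. Y j i) \<longlonglongrightarrow> Z i" "\<And>i. cmod (Z i - Y 0 i) \<le> 2 * d" by metis
  have ZN: "Z i \<in> N (k + i)" for i
    using closed_sequentially[OF attractor_facts(2) _ Z(1)] Y(1) by blast
  have Zo: "(Z (Suc i) - c) ^ q = Z i ^ p" for i
  proof -
    have "(\<lambda>j. (Y j (Suc i) - c) ^ q) \<longlonglongrightarrow> (Z (Suc i) - c) ^ q" by (intro tendsto_intros Z)
    moreover have "(\<lambda>j. (Y j (Suc i) - c) ^ q) = (\<lambda>j. Y j i ^ p)"
      using Y(1) by (simp add: forward_orbit_iff)
    moreover have "(\<lambda>j. Y j i ^ p) \<longlonglongrightarrow> Z i ^ p" by (intro tendsto_intros Z)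
    ultimately show ?thesis using LIMSEQ_unique by metis
  qed
  have "(\<lambda>j. Y (Suc j) 0) \<longlonglongrightarrow> Z 0" using LIMSEQ_Suc[OF Z(1)] .
  moreover have "(\<lambda>j. Y (Suc j) 0) = (\<lambda>j. Y j T)" using Y(2) by simp
  ultimately have ZT: "Z T = Z 0" using Z(1)[of T] LIMSEQ_unique by metis
  have "corr_cycle p q c T (\<lambda>i. Z (i mod T))"
    by (rule cycle_of_path) (use Zo ZT T in \<open>auto simp: path_def\<close>)
  moreover have "Z (i mod T) \<in> N (k + i)" for i
  proof -
    have "k + i = (k + i mod T) + (i div T * m) * n" by (simp add: T_def[symmetric] mult.assoc)
    then show ?thesis using ZN N_mult by metis
  qed
  moreover have "cmod (Z (0 mod T) - y 0) \<le> 2 * d" using Z(2)[of 0] Y(1)[of 0] by simp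
  ultimately show thesis using that unfolding T_def by blast
qed

lemma attractor_shadowing:
  assumes "\<epsilon> > 0"
  obtains \<kappa> where "\<kappa> > 0"
    "\<And>c c' m z k. c \<in> W \<Longrightarrow> c' \<in> W \<Longrightarrow> cmod (c' - c) < \<kappa> \<Longrightarrow> corr_cycle p q c m z \<Longrightarrow> range z \<subseteq> L \<Longrightarrow> z 0 \<in> N k \<Longrightarrow>
       \<exists>m y. corr_cycle p q c' m y \<and> y 0 \<in> N k \<and> cmod (y 0 - z 0) \<le> \<epsilon>"
proof -
  have \<Omega>: "\<Omega> > 0" using attractor_facts(5,6)[of 0] by simp
  show thesis
  proof (rule that[of "\<epsilon> / (4 * \<Omega>)"])
    fix c c' m z k assume c: "c \<in> W" "c' \<in> W" "cmod (c' - c) < \<epsilon> / (4 * \<Omega>)"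
      and z: "corr_cycle p q c m z" "range z \<subseteq> L" "z 0 \<in> N k"
    have zo: "forward_orbit p q c z" and m: "m > 0" using z(1) by (auto simp: corr_cycle_def)
    obtain y where y: "forward_orbit p q c' y" "y 0 = z 0" "\<And>i. y i \<in> N (k + i)"
      "\<And>i. \<omega> (k + i) * cmod (y i - z i) \<le> (1 / 2) ^ i * (\<omega> k * cmod (z 0 - z 0)) + 2 * \<Omega> * cmod (c' - c)"
      using orbit_tracking[OF c(1,2) zo orbit_in_attractor[OF c(1) zo z(2,3)] z(3)] by blast
    have "z (m * n) = z 0" using cycle_add_mult[OF z(1), of 0 n] by (simp add: mult.commute)
    then have d: "\<omega> k * cmod (y (m * n) - y 0) \<le> 2 * \<Omega> * cmod (c' - c)"
      using y(4)[of "m * n"] \<omega>_mult[of k m] y(2) by simp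
    obtain x where x: "corr_cycle p q c' (m * n) x" "\<And>i. x i \<in> N (k + i)"
       "cmod (x 0 - y 0) \<le> 2 * (2 * \<Omega> * cmod (c' - c))"
      using closing[OF c(2) y(1,3) m d] by blast
    have "2 * (2 * \<Omega> * cmod (c' - c)) \<le> \<epsilon>" using c(3) \<Omega> by (simp add: field_simps)
    then show "\<exists>m y. corr_cycle p q c' m y \<and> y 0 \<in> N k \<and> cmod (y 0 - z 0) \<le> \<epsilon>"
      using x(1) x(2)[of 0] x(3) y(2) by (intro exI[of _ "m * n"] exI[of _ x]) simp
  qed (use assms \<Omega> in simp)
qed

end

section \<open>Simple centres\<close>

text \<open>Every cycle either lies in the repeller \<open>U\<close> or avoids it and lies in the attractor. The former
cycles are repelling, the latter attracting, and both kinds are shadowed by cycles of the same kind.\<close>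

lemma locally_continuous_from_attractor:
  assumes rep: "repeller W U R \<delta>" and att: "attractor W L N \<omega> \<Omega> n" and W: "open W"
    and L: "\<And>c m z. c \<in> W \<Longrightarrow> corr_cycle p q c m z \<Longrightarrow> range z \<subseteq> L"
    and U: "U = L - (\<Union>i<n. N i)"
    and c0: "c0 \<in> W"
  shows "locally_continuous c0"
proof -
  have Nmod: "(\<Union>i. N i) = (\<Union>i<n. N i)"
  proof -
    have "N i \<subseteq> (\<Union>i<n. N i)" for i
    proof -
      have "N i = N (i mod n)" using N_mult[OF att, of "i mod n" "i div n"] by simp
      moreover have "i mod n < n" using attractor_facts(1)[OF att] by simp
      ultimately show ?thesis by blast
    qed
    then show ?thesis by blast
  qed
  have inN: "\<exists>k. z 0 \<in> N k" if "c \<in> W" "corr_cycle p q c m z" "\<not> range z \<subseteq> U" for c m z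
  proof -
    have "z 0 \<notin> U" using cycle_in_repeller[OF rep that(1,2), of 0] that(3) by blast
    then show ?thesis using L[OF that(1,2)] U by blast
  qed
  have slow: "(\<Prod>i<m. speed (cmod (z i))) < 1" if c: "c \<in> W" "corr_cycle p q c m z" "\<not> range z \<subseteq> U" for c m z
    using inN[OF c] attractor_speed[OF att c(1,2) L[OF c(1,2)]] by blast
  let ?A = "\<lambda>c. {z 0 |m z. corr_cycle p q c m z \<and> \<not> range z \<subseteq> U}"
  have dual: "dual_julia p q c = closure (?A c)" if c: "c \<in> W" for c
  proof -
    have "\<Union>{range z |m z. corr_cycle p q c m z \<and> (\<Prod>i<m. speed (cmod (z i))) < 1} = ?A c"
      by (rule cycle_points_eq[where Q = "\<lambda>S. \<not> S \<subseteq> U"])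
        (use slow[OF c] cycle_speed_gt_1[OF rep c] in force)
    then show ?thesis unfolding dual_julia_def attracting_iff by simp
  qed
  show ?thesis
    unfolding locally_continuous_def
  proof (intro exI[of _ W] conjI ballI W c0)
    fix c1 assume c1: "c1 \<in> W"
    show "((\<lambda>c. hausdorff_edist (julia p q c) (julia p q c1)) \<longlongrightarrow> 0) (at c1)"
      by (rule julia_continuous[OF rep W _ c1]) (use slow in force)
    show "((\<lambda>c. hausdorff_edist (dual_julia p q c) (dual_julia p q c1)) \<longlongrightarrow> 0) (at c1)"
    proof (rule hausdorff_continuity[OF W c1 dual])
      fix \<epsilon> :: real assume "\<epsilon> > 0"
      then obtain \<kappa> where \<kappa>: "\<kappa> > 0"
        "\<And>c c' m z k. c \<in> W \<Longrightarrow> c' \<in> W \<Longrightarrow> cmod (c' - c) < \<kappa> \<Longrightarrow> corr_cycle p q c m z \<Longrightarrow> range z \<subseteq> L \<Longrightarrow> z 0 \<in> N k \<Longrightarrow>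
           \<exists>m y. corr_cycle p q c' m y \<and> y 0 \<in> N k \<and> cmod (y 0 - z 0) \<le> \<epsilon>"
        using attractor_shadowing[OF att] by metis
      show "\<exists>\<kappa>>0. \<forall>c\<in>W. \<forall>c'\<in>W. dist c' c < \<kappa> \<longrightarrow> (\<forall>x\<in>?A c. \<exists>y\<in>?A c'. dist x y \<le> \<epsilon>)"
      proof (intro exI[of _ \<kappa>] conjI ballI impI \<kappa>(1))
        fix c c' x assume c: "c \<in> W" "c' \<in> W" "dist c' c < \<kappa>" and "x \<in> ?A c"
        then obtain m z where z: "x = z 0" "corr_cycle p q c m z" "\<not> range z \<subseteq> U" by blast
        obtain k where k: "z 0 \<in> N k" using inN[OF c(1) z(2,3)] by blast
        obtain m' y where y: "corr_cycle p q c' m' y" "y 0 \<in> N k" "cmod (y 0 - z 0) \<le> \<epsilon>"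
          using \<kappa>(2)[OF c(1,2) _ z(2) L[OF c(1) z(2)] k] c(3) by (auto simp: dist_norm)
        have "y 0 \<notin> U" unfolding U using y(2) Nmod by blast
        then have "y 0 \<in> ?A c'" using y(1) by blast
        then show "\<exists>y\<in>?A c'. dist x y \<le> \<epsilon>"
          using y(3) z(1) by (intro bexI[of _ "y 0"]) (auto simp: dist_norm norm_minus_commute)
      qed
    qed
  qed
qed


text \<open>Otherwise following the cycle up to \<open>a i\<close> and then leaving it through \<open>v\<close> would give
a second bounded orbit of \<open>0\<close>.\<close>

lemma orbit_leaving_cycle_escapes:
  assumes uniq: "\<And>z. forward_orbit p q c z \<Longrightarrow> z 0 = 0 \<Longrightarrow> bounded (range z) \<Longrightarrow> z = a"
    and a: "forward_orbit p q c a" "a 0 = 0" "bounded (range a)"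
    and v: "(v - c) ^ q = a i ^ p" "v \<noteq> a (Suc i)"
  shows "v \<notin> filled_julia p q c"
proof
  assume "v \<in> filled_julia p q c"
  then obtain z where z: "forward_orbit p q c z" "z 0 = v" "bounded (range z)" by (auto simp: filled_julia_def)
  define b where "b j = (if j \<le> i then a j else z (j - Suc i))" for j
  have "(b (Suc j) - c) ^ q = b j ^ p" for j
  proof -
    consider "j < i" | "j = i" | "j > i" by linarith
    then show ?thesis
    proof cases
      case 3
      then have "Suc j - Suc i = Suc (j - Suc i)" by simp
      then show ?thesis using 3 z(1) by (simp only: b_def forward_orbit_iff) simp
    qed (use a z v in \<open>auto simp: b_def forward_orbit_iff\<close>)
  qed
  then have "forward_orbit p q c b" by (simp add: forward_orbit_iff)
  moreover have "b 0 = 0" using a by (simp add: b_def)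
  moreover have "range b \<subseteq> range a \<union> range z" by (auto simp: b_def)
  then have "bounded (range b)" using a(3) z(3) bounded_Un bounded_subset by blast
  ultimately have "b = a" by (rule uniq)
  then have "b (Suc i) = a (Suc i)" by simp
  then show False using v z(2) by (simp add: b_def)
qed

text \<open>The constants are chosen in this order. First a level \<open>L\<close> whose closure stays at distance
\<open>\<sigma>\<close> from the finite set \<open>X\<close> of points where orbits leave the cycle. Then
weights \<open>\<omega>\<close> that increase by a large factor \<open>s^(n - 1)\<close> in the step from
\<open>0\<close> and drop by the factor \<open>s\<close> in each other step, which compensates the bounded
expansion there. Finally a radius \<open>r\<close> so small that the speed near \<open>0\<close> beats the
factor \<open>s^n\<close>; the discs \<open>N i\<close> have radius \<open>r / \<omega> i\<close>.\<close>

lemma simple_centre_locally_continuous: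
  assumes "simple_centre p q c0"
  shows "locally_continuous c0"
proof -
  obtain a n where a: "corr_cycle p q c0 n a" "a 0 = 0"
    and uniq: "\<And>z. forward_orbit p q c0 z \<Longrightarrow> z 0 = 0 \<Longrightarrow> bounded (range z) \<Longrightarrow> z = a"
    using assms unfolding simple_centre_def by metis
  have ao: "forward_orbit p q c0 a" and n: "n > 0" and an: "a (i + n) = a i" for i
    using a(1) by (auto simp: corr_cycle_def)
  have ab: "bounded (range a)" using cycle_bounded[OF a(1)] .
  have amod: "a i = a (i mod n)" "a (Suc i) = a (Suc (i mod n))" for i
  proof -
    show "a i = a (i mod n)" using cycle_add_mult[OF a(1), of "i mod n" "i div n"] by simp
    have "Suc (i mod n) + i div n * n = Suc i" by simp
    then show "a (Suc i) = a (Suc (i mod n))" using cycle_add_mult[OF a(1)] by metis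
  qed
  define R where "R = 2 ^ q + cmod c0 + 2"
  have R: "2 ^ q < R" "cmod c0 + 1 \<le> R" "cmod c0 + 2 \<le> R" "R > 0"
    using norm_ge_zero[of c0] zero_le_power[of "2::real" q] unfolding R_def by linarith+
  define X where "X = {v. \<exists>i<n. (v - c0) ^ q = a i ^ p \<and> v \<noteq> a (Suc i)}"
  have "X \<subseteq> (\<Union>i<n. (\<lambda>v. v + c0) ` {v. v ^ q = a i ^ p})"
  proof
    fix v assume "v \<in> X"
    then obtain i where "i < n" "(v - c0) ^ q = a i ^ p" by (auto simp: X_def)
    then have "v = (v - c0) + c0" "v - c0 \<in> {v. v ^ q = a i ^ p}" "i \<in> {..<n}" by auto
    then show "v \<in> (\<Union>i<n. (\<lambda>v. v + c0) ` {v. v ^ q = a i ^ p})" by blast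
  qed
  moreover have "finite (\<Union>i<n. (\<lambda>v. v + c0) ` {v. v ^ q = a i ^ p})"
    using q_pos by (intro finite_UN_I finite_imageI finite_nth_roots) auto
  ultimately have Xfin: "finite X" by (rule finite_subset)
  have "\<exists>m. v \<notin> level c0 R m" if "v \<in> X" for v
    using in_all_levels[OF R(1,2), of v] orbit_leaving_cycle_escapes[OF uniq ao a(2) ab] that
    by (auto simp: X_def)
  then obtain f where f: "\<And>v. v \<in> X \<Longrightarrow> v \<notin> level c0 R (f v)" by metis
  define m where "m = Max (insert 0 (f ` X))"
  define L where "L = level c0 R (Suc m)"
  have XL: "v \<notin> closure L" if "v \<in> X" for v
  proof -
    have "f v \<le> m" unfolding m_def using Xfin that by (intro Max_ge) auto
    then have "v \<notin> level c0 R m" using f[OF that] level_antimono[OF R(1,2)] by blast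
    then show ?thesis
      using closure_level[OF R(1,2), of "Suc m"] clevel_Suc_subset_level[OF R(1,2), of m] by (auto simp: L_def)
  qed
  have "X \<subseteq> - closure L" using XL by blast
  then obtain \<sigma> where \<sigma>: "\<sigma> > 0" "(\<Union>v\<in>X. ball v \<sigma>) \<subseteq> - closure L"
    using compact_subset_open_imp_ball_epsilon_subset[OF finite_imp_compact[OF Xfin], of "- closure L"]
    by (auto simp: open_Compl)
  have aL: "a i \<in> L" for i unfolding L_def by (rule bounded_orbit_in_level[OF R(1,2) ao ab])
  have aR: "cmod (a i) < R" for i by (rule bounded_orbit_in_ball[OF R(1,2) ao ab])

  define s where "s = 2 * speed (R + 1) + 1"
  have s: "s \<ge> 1" "speed (R + 1) \<le> s / 2" using speed_nonneg[of "R + 1"] by (auto simp: s_def)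
  define \<Omega> where "\<Omega> = s ^ n"
  have \<Omega>: "\<Omega> \<ge> 1" using s(1) by (simp add: \<Omega>_def)
  define \<omega> where "\<omega> i = (if i mod n = 0 then 1 else s ^ (n - i mod n))" for i
  have \<omega>: "1 \<le> \<omega> i" "\<omega> i \<le> \<Omega>" for i
    using s(1) by (auto simp: \<omega>_def \<Omega>_def intro: power_increasing)
  have \<omega>_Suc: "\<omega> (Suc i) = s ^ (n - Suc (i mod n))" for i
    using n by (auto simp: \<omega>_def mod_Suc)
  have "\<forall>\<^sub>F t in at_right 0. speed t < 1 / (2 * \<Omega>)"
    using order_tendstoD(2)[OF speed_tendsto_0] \<Omega> by simp
  then obtain r0 where r0: "r0 > 0" "\<And>t. 0 < t \<Longrightarrow> t < r0 \<Longrightarrow> speed t < 1 / (2 * \<Omega>)"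
    by (auto simp: eventually_at_right_field)
  define r where "r = min (r0 / 2) (min 1 (\<sigma> / 8))"
  have r: "r > 0" "r \<le> 1" "8 * r \<le> \<sigma>" "speed r < 1 / (2 * \<Omega>)"
    using r0 \<sigma>(1) by (auto simp: r_def)
  \<comment> \<open>a bound for the modulus on the \<open>i\<close>-th disc, hence \<open>speed (B i)\<close> is a Lipschitz constant there\<close>
  define B where "B i = (if i mod n = 0 then r else R + 1)" for i
  have lip: "\<omega> (Suc i) * speed (B i) \<le> 1 / 2 * \<omega> i" for i
  proof (cases "i mod n = 0")
    case True
    have "\<omega> (Suc i) * speed (B i) \<le> \<Omega> * (1 / (2 * \<Omega>))"
      using \<omega>(2)[of "Suc i"] r(4) \<Omega> True speed_nonneg[of r] by (intro mult_mono) (auto simp: B_def)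
    then show ?thesis using \<Omega> True by (simp add: \<omega>_def)
  next
    case False
    have "\<omega> (Suc i) * speed (B i) \<le> s ^ (n - Suc (i mod n)) * (s / 2)"
      unfolding \<omega>_Suc using s False by (intro mult_left_mono) (auto simp: B_def)
    also have "\<dots> = 1 / 2 * s ^ Suc (n - Suc (i mod n))" by simp
    also have "Suc (n - Suc (i mod n)) = n - i mod n" using n by (simp add: Suc_diff_Suc)
    finally show ?thesis using False by (simp add: \<omega>_def)
  qed
  define \<rho> where "\<rho> i = r / \<omega> i" for i
  have \<rho>: "0 < \<rho> i" "\<rho> i \<le> r" "r / \<Omega> \<le> \<rho> i" for i
    using r(1) \<omega>[of i] \<Omega> by (auto simp: \<rho>_def field_simps)
  have lip\<rho>: "speed (B i) * \<rho> i \<le> \<rho> (Suc i) / 2" for i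
  proof -
    have "0 < \<omega> i" "0 < \<omega> (Suc i)" using \<omega>(1)[of i] \<omega>(1)[of "Suc i"] by linarith+
    moreover from this have "r * (\<omega> (Suc i) * speed (B i)) \<le> r * (1 / 2 * \<omega> i)"
      using lip[of i] r(1) by (intro mult_left_mono) auto
    ultimately show ?thesis by (simp add: \<rho>_def field_simps)
  qed
  define N where "N i = cball (a i) (\<rho> i)" for i
  have NB: "cmod z \<le> B i" if "z \<in> N i" for z i
  proof (cases "i mod n = 0")
    case True
    then have "a i = 0" using amod(1)[of i] a(2) by simp
    then show ?thesis using that \<rho>(2)[of i] True by (simp add: N_def B_def)
  next
    case False
    have "cmod z \<le> cmod (a i) + \<rho> i"
      using that norm_triangle_sub[of z "a i"] by (simp add: N_def dist_norm norm_minus_commute)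
    then show ?thesis using aR[of i] \<rho>(2)[of i] r(2) False by (simp add: B_def)
  qed
  have aN: "a i \<in> N i" for i using \<rho>(1)[of i] by (simp add: N_def less_imp_le)

  \<comment> \<open>images of the \<open>i\<close>-th disc are close either to the next point of the cycle or to a point of \<open>X\<close>\<close>
  have dichotomy: "\<exists>x. cmod (w - x) < \<rho> (Suc i) \<and> (x = a (Suc i) \<or> ball x \<sigma> \<inter> closure L = {})"
    if c: "cmod (c - c0) < r / (4 * \<Omega>)" and z: "z \<in> N i" and w: "(w - c) ^ q = z ^ p" for c z w i
  proof -
    obtain v where v: "v ^ q = a i ^ p" "cmod (v - (w - c)) \<le> speed (B i) * cmod (a i - z)"
      using forward_lipschitz[OF w NB[OF z] NB[OF aN]] by blast
    have "speed (B i) * cmod (a i - z) \<le> speed (B i) * \<rho> i"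
      using z speed_nonneg by (intro mult_left_mono) (auto simp: N_def dist_norm)
    then have 1: "cmod (v - (w - c)) \<le> \<rho> (Suc i) / 2" using v(2) lip\<rho>[of i] by simp
    have "r / (4 * \<Omega>) \<le> \<rho> (Suc i) / 4" using \<rho>(3)[of "Suc i"] by simp
    moreover have "w - (v + c0) = (c - c0) - (v - (w - c))" by simp
    then have "cmod (w - (v + c0)) \<le> cmod (c - c0) + cmod (v - (w - c))"
      by (metis norm_triangle_ineq4)
    ultimately have 2: "cmod (w - (v + c0)) < \<rho> (Suc i)" using 1 c \<rho>(1)[of "Suc i"] by linarith
    have "v + c0 = a (Suc i) \<or> v + c0 \<in> X"
      using v(1) amod[of i] n unfolding X_def
      by (intro disjCI CollectI exI[of _ "i mod n"]) auto
    then show ?thesis using 2 \<sigma>(2) by (intro exI[of _ "v + c0"]) blast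
  qed
  have image_near: "cmod (w - a (Suc i)) < \<rho> (Suc i)"
    if c: "cmod (c - c0) < r / (4 * \<Omega>)" and z: "z \<in> N i" and w: "(w - c) ^ q = z ^ p" "w \<in> closure L" for c z w i
  proof -
    obtain x where x: "cmod (w - x) < \<rho> (Suc i)" "x = a (Suc i) \<or> ball x \<sigma> \<inter> closure L = {}"
      using dichotomy[OF c z w(1)] by blast
    have "w \<in> ball x \<sigma>" using x(1) \<rho>(2)[of "Suc i"] r \<sigma>(1) by (simp add: dist_norm norm_minus_commute)
    then show ?thesis using x w(2) by blast
  qed
  have track: "\<exists>w'\<in>N (Suc i). (w' - c') ^ q = y ^ p \<and>
        \<omega> (Suc i) * cmod (w' - w) \<le> 1 / 2 * (\<omega> i * cmod (y - z)) + \<Omega> * cmod (c' - c)"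
    if c: "cmod (c - c0) < r / (4 * \<Omega>)" "cmod (c' - c0) < r / (4 * \<Omega>)"
      and z: "z \<in> N i" "y \<in> N i" "w \<in> N (Suc i)" "(w - c) ^ q = z ^ p" for c c' z y w i
  proof -
    obtain v where v: "v ^ q = y ^ p" "cmod (v - (w - c)) \<le> speed (B i) * cmod (y - z)"
      using forward_lipschitz[OF z(4) NB[OF z(1)] NB[OF z(2)]] by blast
    define w' where "w' = v + c'"
    have e: "(w' - c') ^ q = y ^ p" using v(1) by (simp add: w'_def)
    have "w' - w = (v - (w - c)) + (c' - c)" by (simp add: w'_def)
    then have "cmod (w' - w) \<le> cmod (v - (w - c)) + cmod (c' - c)"
      by (metis norm_triangle_ineq)
    then have d: "cmod (w' - w) \<le> speed (B i) * cmod (y - z) + cmod (c' - c)"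
      using v(2) by linarith
    have \<omega>0: "0 \<le> \<omega> (Suc i)" using \<omega>(1)[of "Suc i"] by simp
    have "\<omega> (Suc i) * cmod (w' - w) \<le> \<omega> (Suc i) * (speed (B i) * cmod (y - z) + cmod (c' - c))"
      using d \<omega>0 by (rule mult_left_mono)
    also have "\<dots> = (\<omega> (Suc i) * speed (B i)) * cmod (y - z) + \<omega> (Suc i) * cmod (c' - c)"
      by (simp add: algebra_simps)
    also have "\<dots> \<le> (1 / 2 * \<omega> i) * cmod (y - z) + \<Omega> * cmod (c' - c)"
      using lip[of i] \<omega>(2)[of "Suc i"] by (intro add_mono mult_right_mono) auto
    finally have t: "\<omega> (Suc i) * cmod (w' - w) \<le> 1 / 2 * (\<omega> i * cmod (y - z)) + \<Omega> * cmod (c' - c)"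
      by simp
    obtain x where x: "cmod (w' - x) < \<rho> (Suc i)" "x = a (Suc i) \<or> ball x \<sigma> \<inter> closure L = {}"
      using dichotomy[OF c(2) z(2) e] by blast
    \<comment> \<open>the tracking point cannot have jumped to another branch, because those are \<open>\<sigma>\<close>-far from the cycle\<close>
    have "x = a (Suc i)"
    proof (rule ccontr)
      assume "x \<noteq> a (Suc i)"
      then have "a (Suc i) \<notin> ball x \<sigma>" using x(2) aL[of "Suc i"] closure_subset by blast
      then have far: "\<sigma> \<le> cmod (x - a (Suc i))" by (simp add: dist_norm)
      have "cmod (y - z) \<le> \<rho> i + \<rho> i"
        using z(1,2) dist_triangle[of y z "a i"] by (simp add: N_def dist_norm norm_minus_commute)
      then have "speed (B i) * cmod (y - z) \<le> speed (B i) * (\<rho> i + \<rho> i)"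
        using speed_nonneg by (intro mult_left_mono)
      then have 1: "speed (B i) * cmod (y - z) \<le> \<rho> (Suc i)" using lip\<rho>[of i] by (simp add: algebra_simps)
      have "r / (4 * \<Omega>) \<le> r / 4" using r(1) \<Omega> by (simp add: field_simps)
      then have 2: "cmod (c' - c) \<le> r" 
        using c norm_triangle_ineq4[of "c' - c0" "c - c0"] r(1) by simp
      have "cmod (x - a (Suc i)) \<le> cmod (x - w') + cmod (w' - w) + cmod (w - a (Suc i))"
        using norm_triangle_ineq[of "x - w'" "w' - w"] norm_triangle_ineq[of "x - w" "w - a (Suc i)"] by simp
      also have "\<dots> \<le> r + (r + r) + r"
        using x(1) d 1 2 z(3) \<rho>(2)[of "Suc i"] by (auto simp: N_def dist_norm norm_minus_commute)
      finally show False using far r by simp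
    qed
    then have "w' \<in> N (Suc i)" using x(1) by (simp add: N_def dist_norm norm_minus_commute)
    then show ?thesis using e t by blast
  qed

  define U where "U = L - (\<Union>i<n. N i)"
  have "closed (\<Union>i<n. N i)" by (intro closed_UN) (auto simp: N_def)
  then have oU: "open U" unfolding U_def L_def by (intro open_Diff open_level)
  have UR: "U \<subseteq> ball 0 R" using level_subset_ball[OF R(1,2)] by (auto simp: U_def L_def)
  have U0: "0 \<notin> U" using aN[of 0] a(2) n by (auto simp: U_def)
  have inv: "pre c0 (closure U) \<subseteq> U"
  proof
    fix z assume "z \<in> pre c0 (closure U)"
    then obtain w where w: "w \<in> closure U" "(w - c0) ^ q = z ^ p" by (auto simp: pre_def)
    have wL: "w \<in> closure L" using w(1) closure_mono[of U L] by (auto simp: U_def)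
    then have "z \<in> pre c0 (closure L)" using w(2) by (auto simp: pre_def)
    then have zL: "z \<in> L" using pre_closure_level[OF R(1,2)] by (auto simp: L_def)
    have "z \<notin> N i" if i: "i < n" for i
    proof
      assume "z \<in> N i"
      then have "cmod (w - a (Suc i)) < \<rho> (Suc i)"
        using image_near[of c0 z i w] w(2) wL r \<Omega> by simp
      then have "w \<in> ball (a (Suc i)) (\<rho> (Suc i))" by (simp add: dist_norm norm_minus_commute)
      moreover have "ball (a (Suc i)) (\<rho> (Suc i)) \<inter> U = {}"
      proof -
        have "a (Suc i) = a (Suc i mod n)" "\<rho> (Suc i) = \<rho> (Suc i mod n)"
          using amod(1) by (auto simp: \<rho>_def \<omega>_def)
        moreover have "Suc i mod n < n" using n by simp
        ultimately show ?thesis using ball_subset_cball by (fastforce simp: U_def N_def)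
      qed
      ultimately show False using w(1) open_Int_closure_eq_empty[OF open_ball] by blast
    qed
    then show "z \<in> U" using zL by (simp add: U_def)
  qed
  obtain \<kappa>1 \<delta> where \<kappa>1: "\<kappa>1 > 0" "repeller (ball c0 \<kappa>1) U R \<delta>"
    using repeller_nearby[OF oU UR U0 R(2) inv] by blast
  obtain \<kappa>2 where \<kappa>2: "\<kappa>2 > 0"
    "\<And>c' z i. cmod (c' - c0) < \<kappa>2 \<Longrightarrow> forward_orbit p q c' z \<Longrightarrow> bounded (range z) \<Longrightarrow> z i \<in> L"
    using bounded_orbits_in_level_nearby[OF R(1,3)] unfolding L_def by metis
  define W where "W = ball c0 (min (r / (4 * \<Omega>)) (min \<kappa>1 \<kappa>2))"
  have W: "open W" "c0 \<in> W" "W \<subseteq> ball c0 \<kappa>1" using \<kappa>1(1) \<kappa>2(1) r(1) \<Omega> by (auto simp: W_def)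
  have Wr: "cmod (c - c0) < r / (4 * \<Omega>)" "cmod (c - c0) < \<kappa>2" if "c \<in> W" for c
    using that by (auto simp: W_def dist_norm norm_minus_commute)
  have rep: "repeller W U R \<delta>" using \<kappa>1(2) W(3) unfolding repeller_def by blast
  have att: "attractor W L N \<omega> \<Omega> n"
    unfolding attractor_def
  proof (intro conjI allI ballI impI)
    show "n > 0" by (rule n)
  next
    fix i
    show "closed (N i)" by (simp add: N_def)
    show "N (i + n) = N i" "\<omega> (i + n) = \<omega> i" by (simp_all add: N_def \<rho>_def \<omega>_def an)
    show "1 \<le> \<omega> i" "\<omega> i \<le> \<Omega>" by (rule \<omega>)+
  next
    fix i c z w assume *: "c \<in> W" "z \<in> N i" "w \<in> L" "(w - c) ^ q = z ^ p"
    have "w \<in> closure L" using *(3) closure_subset by blast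
    then have "cmod (w - a (Suc i)) < \<rho> (Suc i)" using image_near[OF Wr(1)] * by blast
    then show "w \<in> N (Suc i)" by (simp add: N_def dist_norm norm_minus_commute)
  next
    fix i c c' z y w assume "c \<in> W" "c' \<in> W" "z \<in> N i" "y \<in> N i" "w \<in> N (Suc i)" "(w - c) ^ q = z ^ p"
    then show "\<exists>w'\<in>N (Suc i). (w' - c') ^ q = y ^ p \<and>
        \<omega> (Suc i) * cmod (w' - w) \<le> 1 / 2 * (\<omega> i * cmod (y - z)) + \<Omega> * cmod (c' - c)"
      using track[OF Wr(1) Wr(1)] by blast
  next
    fix i z assume "z \<in> N i"
    then have "speed (cmod z) \<le> speed (B i)" using NB by (intro speed_mono) auto
    then have "\<omega> (Suc i) * speed (cmod z) \<le> \<omega> (Suc i) * speed (B i)"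
      using \<omega>(1)[of "Suc i"] by (intro mult_left_mono) auto
    then show "\<omega> (Suc i) * speed (cmod z) \<le> 1 / 2 * \<omega> i" using lip[of i] by simp
  qed
  show ?thesis
  proof (rule locally_continuous_from_attractor[OF rep att W(1) _ U_def W(2)])
    fix c m z assume c: "c \<in> W" and z: "corr_cycle p q c m z"
    show "range z \<subseteq> L"
      using \<kappa>2(2)[OF Wr(2)[OF c] _ cycle_bounded[OF z]] z by (auto simp: corr_cycle_def)
  qed
qed

end

theorem theorem1p3:
  fixes p q :: nat
  assumes "q \<ge> 1" and "p > q"
  shows "\<exists>H :: complex set. open H \<and> - mandel p q \<subseteq> H \<and> {c. simple_centre p q c} \<subseteq> H \<and>
    hausdorff_continuous_on H (julia p q) \<and> hausdorff_continuous_on H (dual_julia p q)"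
proof -
  interpret correspondence p q by standard (use assms in auto)
  let ?cont = "\<lambda>c1. ((\<lambda>c. hausdorff_edist (julia p q c) (julia p q c1)) \<longlongrightarrow> 0) (at c1) \<and>
     ((\<lambda>c. hausdorff_edist (dual_julia p q c) (dual_julia p q c1)) \<longlongrightarrow> 0) (at c1)"
  define H where "H = \<Union>{W. open W \<and> (\<forall>c1\<in>W. ?cont c1)}"
  have H: "c \<in> H" if "locally_continuous c" for c
    using that unfolding locally_continuous_def H_def by blast
  have "((\<lambda>c. hausdorff_edist (julia p q c) (julia p q c1)) \<longlongrightarrow> 0) (at c1 within H)"
    "((\<lambda>c. hausdorff_edist (dual_julia p q c) (dual_julia p q c1)) \<longlongrightarrow> 0) (at c1 within H)" if "c1 \<in> H" for c1
  proof -
    have "?cont c1" using that unfolding H_def by blast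
    then show "((\<lambda>c. hausdorff_edist (julia p q c) (julia p q c1)) \<longlongrightarrow> 0) (at c1 within H)"
      "((\<lambda>c. hausdorff_edist (dual_julia p q c) (dual_julia p q c1)) \<longlongrightarrow> 0) (at c1 within H)"
      by (auto intro: tendsto_within_subset)
  qed
  then have "hausdorff_continuous_on H (julia p q)" "hausdorff_continuous_on H (dual_julia p q)"
    by (simp_all add: hausdorff_continuous_on_def)
  moreover have "open H" unfolding H_def by (intro open_Union) blast
  moreover have "- mandel p q \<subseteq> H" using outside_mandel H by blast
  moreover have "{c. simple_centre p q c} \<subseteq> H" using simple_centre_locally_continuous H by blast
  ultimately show ?thesis by blast
qed

end
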